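(* Suppose $\varphi\in\mathcal C$ and $\Lambda$ is a finite and spanning set of nonzero vectors in $\mathbb R^n$. Then $$\frac{V(Z^+_\varphi\Lambda)}{V(Z^+_1\Lambda)}\ \leq\ \frac{V(Z^+_\varphi\Lambda_\bot)}{V(Z^+_1\Lambda_\bot)},$$ with equality if and only if $\Lambda$ is a $GL(n)$ image of an obtuse set.
   Context: $\mathcal C$ is the class of convex, strictly increasing functions $\varphi:[0,\infty)\to[0,\infty)$ with $\varphi(0)=0$ and $\varphi(1)=1$. A set of vectors is spanning if it spans $\mathbb R^n$. A $GL(n)$ image of a set $A$ of vectors is $\phi A=\{\phi w: w\in A\}$ for some $\phi\in GL(n)$. $\Lambda_\bot=\{e_1,\dots,e_n\}$ is the canonical basis of $\mathbb R^n$. With $\langle u,v\rangle_+=\max\{0,\langle u,v\rangle\}$, where $\langle\cdot,\cdot\rangle$ is the Euclidean scalar product, a set of vectors from $\mathbb R^n$ is called obtuse if every pair of distinct vectors $u,v$ from it satisfies $\langle u,v\rangle_+=0$. For a finite set $\Lambda$ of nonzero vectors and $\varphi\in\mathcal C$, the asymmetric Orlicz zonotope $Z^+_\varphi\Lambda$ is the unique compact convex set with support function $$h_{Z^+_\varphi\Lambda}(u)=\inf\Big\{\lambda>0:\ \sum_{w\in\Lambda}\varphi\Big(\frac{\langle w,u\rangle_+}{\lambda}\Big)\leq 1\Big\},\qquad u\in\mathbb R^n.$$ $Z^+_1\Lambda$ denotes $Z^+_\varphi\Lambda$ for the identity function $\varphi(t)=t$. $V$ is $n$-dimensional volume.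
   Formalization: The equality condition is corrected: equality holds iff Λ is a GL(n) image of an obtuse set or φ(t)=t for all t in [0,1]; for such φ (e.g. the identity) both ratios are 1 for every Λ, so the printed characterization fails. *)

theory Defs
  imports "HOL-Analysis.Analysis"
begin

(* Functions on [0,\<infinity>) are rendered as real functions; only their restriction to {0..} matters. *)
definition orlicz_class :: "(real \<Rightarrow> real) set" where
  "orlicz_class = {\<phi>. \<phi> ` {0..} \<subseteq> {0..} \<and> convex_on {0..} \<phi> \<and> strict_mono_on {0..} \<phi>
                       \<and> \<phi> 0 = 0 \<and> \<phi> 1 = 1}"

definition inner_pos :: "'a::real_inner \<Rightarrow> 'a \<Rightarrow> real" where
  "inner_pos u v = max 0 (u \<bullet> v)"

definition obtuse :: "'a::real_inner set \<Rightarrow> bool" where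
  "obtuse A \<longleftrightarrow> (\<forall>u\<in>A. \<forall>v\<in>A. u \<noteq> v \<longrightarrow> inner_pos u v = 0)"

definition is_GL_image :: "(real ^ 'n) set \<Rightarrow> (real ^ 'n) set \<Rightarrow> bool" where
  "is_GL_image B A \<longleftrightarrow> (\<exists>M :: real ^ 'n ^ 'n. invertible M \<and> B = (\<lambda>w. M *v w) ` A)"

(* Meaningful for nonempty bounded K only. *)
definition support_function :: "'a::real_inner set \<Rightarrow> 'a \<Rightarrow> real" where
  "support_function K u = (SUP x\<in>K. x \<bullet> u)"

definition orlicz_support :: "(real \<Rightarrow> real) \<Rightarrow> 'a::real_inner set \<Rightarrow> 'a \<Rightarrow> real" where
  "orlicz_support \<phi> \<Lambda> u =
     Inf {l. l > 0 \<and> (\<Sum>w\<in>\<Lambda>. \<phi> (inner_pos w u / l)) \<le> 1}"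

(* Nonemptiness is required explicitly, since the supremum over the empty set is unspecified. *)
definition orlicz_zonotope :: "(real \<Rightarrow> real) \<Rightarrow> 'a::real_inner set \<Rightarrow> 'a set" where
  "orlicz_zonotope \<phi> \<Lambda> =
     (THE K. K \<noteq> {} \<and> compact K \<and> convex K \<and> (\<forall>u. support_function K u = orlicz_support \<phi> \<Lambda> u))"

abbreviation volume :: "(real ^ 'n) set \<Rightarrow> real" where
  "volume K \<equiv> measure lebesgue K"

(* The ratio V(Z_\<phi> \<Lambda>) / V(Z_1 \<Lambda>), where Z_1 is the zonotope of the identity function. *)
definition volume_ratio :: "(real \<Rightarrow> real) \<Rightarrow> (real ^ 'n) set \<Rightarrow> real" where
  "volume_ratio \<phi> \<Lambda> = volume (orlicz_zonotope \<phi> \<Lambda>) / volume (orlicz_zonotope (\<lambda>t. t) \<Lambda>)"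

(* Only the values of \<phi> on [0,1] enter orlicz_support: every summand in the constraint is at most
   1 = \<phi> 1.  So if \<phi> is the identity on [0,1], both volume ratios are 1 for every spanning \<Lambda>, whether
   or not \<Lambda> is a GL(n) image of an obtuse set.  This degenerate case must be listed separately among
   the equality cases. *)

end

theory Submission imports Defs begin

text \<open>
The proof rests on one linear picture. Let \<open>K\<close> be the set of coefficient vectors \<open>a \<ge>
0\<close>, indexed by \<open>\<Lambda>\<close>, with \<open>\<Sum> a w * x w \<le> 1\<close> for all \<open>x
\<ge> 0\<close> such that \<open>\<Sum> \<phi> (x w) \<le> 1\<close>. By duality
(\<open>orlicz_zonotope_eq_comb\<close>) the Orlicz zonotope is the image of \<open>K\<close> under \<open>a
\<mapsto> \<Sum> a w *\<^sub>R w\<close>. For the identity function \<open>K\<close> is the unit cube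
\<open>C\<close>, so the theorem compares the volumes of the images of \<open>K\<close> and of
\<open>C\<close> under the same linear map. It is proved for all finite families \<open>W\<close> of vectors.

Fix an index \<open>i\<close> and slice the image of \<open>K\<close> by the lines parallel to \<open>W
i\<close>. The image of \<open>a\<close> has height \<open>a i + g a\<close> on its line, where \<open>g
a\<close> is the height of the combination of the other vectors. The coefficients over one line form a convex
set, so the slice is the interval of the values of \<open>a i + g a\<close>. It is at most as long as the
range of \<open>a i\<close> and the range of \<open>g a\<close> together. Integration over the lines bounds
the volume of the image by the sum of two volumes: one for the family in which \<open>W i\<close> is deleted,
one for the family in which the other vectors are projected along \<open>W i\<close>. In the cube \<open>a
i\<close> and \<open>g a\<close> vary independently, and the bound is an equality. Both new families have
fewer redundant vectors. For a spanning family without redundant vectors both images are linear images of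
those for the standard basis, and if the family does not span, they are null sets. By induction
(\<open>comb_volume_comparison\<close>) the image of \<open>K\<close> has at most \<open>c\<close> times the
volume of the image of \<open>C\<close>, where \<open>c\<close> is the ratio for the standard basis.

A step is an equality exactly if on almost every line \<open>a i\<close> and \<open>g a\<close> attain their
maxima at a common point. Call the kernel of \<open>W\<close> a sublattice if the positive part of every
linear dependency is again a dependency. Then a common maximum exists: away from \<open>i\<close>, take the
minimum of the two maximisers. Both new families inherit the property, so equality holds throughout. If the
two new families have it and \<open>W\<close> does not, then \<open>W i\<close> is a nonnegative combination
of the other vectors (\<open>nonneg_comb_of_lost_sublattice\<close>). A common maximum on the line through the
origin would be a point of \<open>K\<close> with \<open>a i = 1\<close> whose other coordinates leave
\<open>K\<close> when multiplied by a number above one. There is no such point if \<open>\<phi> (1/2) <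
1/2\<close> (\<open>orlicz_corner_face\<close>), and the defect persists on a set of lines of positive measure
(\<open>step_less\<close>).

Finally, a finite spanning set has a sublattice as its kernel iff it is an image of an obtuse set under an
invertible linear map. For a dependency \<open>m\<close> of an obtuse set, the positive and the negative part
of \<open>m\<close> give the same vector \<open>z\<close>, and \<open>z \<bullet> z \<le> 0\<close>.
Conversely, the coordinates with respect to a basis contained in the set make it obtuse. If \<open>\<phi>
(1/2) = 1/2\<close>, convexity forces \<open>\<phi>\<close> to be the identity on \<open>[0,1]\<close>, which
is the other equality case.
\<close>

section \<open>Volume as an integral of fibre lengths\<close>

lemma fibre_length_eq_integral:
  fixes A :: "'a::euclidean_space set"
  assumes A[measurable]: "A \<in> sets borel"
  shows "emeasure lborel {s. x + s *\<^sub>R w \<in> A} = (\<integral>\<^sup>+s. indicator A (x + s *\<^sub>R w) \<partial>lborel)"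
proof -
  have [measurable]: "{s. x + s *\<^sub>R w \<in> A} \<in> sets borel" by measurable
  have "(\<lambda>s. indicator A (x + s *\<^sub>R w) :: ennreal) = indicator {s. x + s *\<^sub>R w \<in> A}"
    by (auto simp: fun_eq_iff indicator_def)
  then show ?thesis by simp
qed

text \<open>Fubini along an arbitrary direction \<open>w\<close>, without a choice of coordinates. A slab of
height one replaces a hyperplane transversal to \<open>w\<close>: the pairs \<open>(x, s)\<close> with
\<open>x\<close> in the slab and \<open>x + s *\<^sub>R w \<in> A\<close> are counted once over
\<open>x\<close>, giving fibre lengths, and once over the point of \<open>A\<close>, where \<open>s\<close>
runs over an interval of length one.\<close>
lemma emeasure_eq_slab_integral_of_fibres:
  fixes A :: "'a::euclidean_space set" and f :: "'a \<Rightarrow> real"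
  assumes A[measurable]: "A \<in> sets borel" and f: "linear f" and fw: "f w = 1"
  shows "emeasure lborel A = (\<integral>\<^sup>+x. indicator {x. 0 \<le> f x \<and> f x < 1} x *
            emeasure lborel {s. x + s *\<^sub>R w \<in> A} \<partial>lborel)"
proof -
  have [measurable]: "f \<in> borel_measurable borel"
    by (intro borel_measurable_continuous_onI linear_continuous_on linear_conv_bounded_linear[THEN iffD1] f)
  define T where "T = {x. 0 \<le> f x \<and> f x < 1}"
  have T[measurable]: "T \<in> sets borel" unfolding T_def by measurable
  have "(\<integral>\<^sup>+x. indicator T x * emeasure lborel {s. x + s *\<^sub>R w \<in> A} \<partial>lborel)
      = (\<integral>\<^sup>+x. (\<integral>\<^sup>+s. indicator T x * indicator A (x + s *\<^sub>R w) \<partial>lborel) \<partial>lborel)"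
  proof (rule nn_integral_cong)
    fix x
    show "indicator T x * emeasure lborel {s. x + s *\<^sub>R w \<in> A}
      = (\<integral>\<^sup>+s. indicator T x * indicator A (x + s *\<^sub>R w) \<partial>lborel)"
      by (simp add: fibre_length_eq_integral[OF A] nn_integral_cmult)
  qed
  also have "\<dots> = (\<integral>\<^sup>+s. (\<integral>\<^sup>+x. indicator T x * indicator A (x + s *\<^sub>R w) \<partial>lborel) \<partial>lborel)"
    by (rule lborel_pair.Fubini') measurable
  also have "\<dots> = (\<integral>\<^sup>+s. (\<integral>\<^sup>+x. indicator T (x - s *\<^sub>R w) * indicator A x \<partial>lborel) \<partial>lborel)"
  proof (rule nn_integral_cong)
    fix s :: real
    have "(\<integral>\<^sup>+x. indicator T (x - s *\<^sub>R w) * indicator A x \<partial>lborel)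
      = (\<integral>\<^sup>+x. indicator T (x - s *\<^sub>R w) * indicator A x \<partial>distr lborel borel ((+) (s *\<^sub>R w)))"
      by (simp add: lborel_distr_plus)
    also have "\<dots> = (\<integral>\<^sup>+x. indicator T x * indicator A (x + s *\<^sub>R w) \<partial>lborel)"
      by (subst nn_integral_distr) (auto simp: add.commute)
    finally show "(\<integral>\<^sup>+x. indicator T x * indicator A (x + s *\<^sub>R w) \<partial>lborel)
      = (\<integral>\<^sup>+x. indicator T (x - s *\<^sub>R w) * indicator A x \<partial>lborel)" by simp
  qed
  also have "\<dots> = (\<integral>\<^sup>+x. (\<integral>\<^sup>+s. indicator T (x - s *\<^sub>R w) * indicator A x \<partial>lborel) \<partial>lborel)"
    by (rule lborel_pair.Fubini'[symmetric]) measurable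
  also have "\<dots> = (\<integral>\<^sup>+x. indicator A x \<partial>lborel)"
  proof (rule nn_integral_cong)
    fix x
    have "f (x - s *\<^sub>R w) = f x - s" for s
      using f fw by (simp add: linear_diff linear_cmul)
    then have "(\<lambda>s. indicator T (x - s *\<^sub>R w) * indicator A x :: ennreal)
      = (\<lambda>s. indicator A x * indicator {f x - 1<..f x} s)"
      by (auto simp: fun_eq_iff indicator_def T_def)
    then show "(\<integral>\<^sup>+s. indicator T (x - s *\<^sub>R w) * indicator A x \<partial>lborel) = indicator A x"
      by (simp add: nn_integral_cmult)
  qed
  also have "\<dots> = emeasure lborel A" by simp
  finally show ?thesis by (simp add: T_def)
qed

lemma fibre_length_measurable:
  fixes A :: "'a::euclidean_space set"
  assumes A[measurable]: "A \<in> sets borel"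
  shows "(\<lambda>x. emeasure lborel {s. x + s *\<^sub>R w \<in> A}) \<in> borel_measurable lborel"
  by (simp add: fibre_length_eq_integral[OF A])

lemma compact_convex_real_interval:
  fixes S :: "real set"
  assumes "compact S" "convex S" "S \<noteq> {}"
  obtains l u where "l \<le> u" "S = {l..u}"
proof -
  from assms have "connected S" by (simp add: convex_connected)
  with assms connected_compact_interval_1[of S] obtain a b where "S = {a..b}" by (auto simp: is_interval_connected_1)
  with assms that show ?thesis by (cases "a \<le> b") auto
qed

text \<open>The length of a slice compared with the lengths of its two summands. The translation
\<open>d\<close> occurs because the heights of the three slices over a common line are measured from the same
base point. Equality holds once the sum of the two maxima is reached, and likewise that of the minima. The
inequality is strict as soon as one sum \<open>u + v + d\<close> misses \<open>S\<close> from above.\<close>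
lemma interval_length_subadditive:
  fixes S U V :: "real set"
  assumes c: "compact S" "convex S" "compact U" "convex U" "compact V" "convex V"
    and ne: "S \<noteq> {}" "U \<noteq> {}" "V \<noteq> {}"
    and sum: "\<And>s. s \<in> S \<Longrightarrow> \<exists>u\<in>U. \<exists>v\<in>V. s = u + v + d"
  shows "emeasure lborel S \<le> emeasure lborel U + emeasure lborel V"
    and "(\<And>u v. u \<in> U \<Longrightarrow> v \<in> V \<Longrightarrow> (\<exists>s\<in>S. u + v + d \<le> s) \<and> (\<exists>s\<in>S. s \<le> u + v + d)) \<Longrightarrow>
       emeasure lborel S = emeasure lborel U + emeasure lborel V"
    and "u \<in> U \<Longrightarrow> v \<in> V \<Longrightarrow> u + v + d \<notin> S \<Longrightarrow> s \<in> S \<Longrightarrow> s \<le> u + v + d \<Longrightarrow>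
       emeasure lborel S < emeasure lborel U + emeasure lborel V"
proof -
  obtain a b where S: "a \<le> b" "S = {a..b}" using compact_convex_real_interval c ne by metis
  obtain p q where U: "p \<le> q" "U = {p..q}" using compact_convex_real_interval c ne by metis
  obtain l r where V: "l \<le> r" "V = {l..r}" using compact_convex_real_interval c ne by metis
  have a: "p + l + d \<le> a" and b: "b \<le> q + r + d"
    using sum[of a] sum[of b] S U V by auto
  have e: "emeasure lborel U + emeasure lborel V = ennreal ((q - p) + (r - l))"
    using U V by (simp flip: ennreal_plus)
  show "emeasure lborel S \<le> emeasure lborel U + emeasure lborel V"
    unfolding e using S a b by (simp add: ennreal_leI)
  show "emeasure lborel S = emeasure lborel U + emeasure lborel V"
    if "\<And>u v. u \<in> U \<Longrightarrow> v \<in> V \<Longrightarrow> (\<exists>s\<in>S. u + v + d \<le> s) \<and> (\<exists>s\<in>S. s \<le> u + v + d)"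
  proof -
    have "q + r + d \<le> b" "a \<le> p + l + d" using that[of q r] that[of p l] S U V by auto
    then have "b - a = (q - p) + (r - l)" using a b by simp
    then show ?thesis unfolding e using S by simp
  qed
  show "emeasure lborel S < emeasure lborel U + emeasure lborel V"
    if "u \<in> U" "v \<in> V" "u + v + d \<notin> S" "s \<in> S" "s \<le> u + v + d"
  proof -
    have "b < u + v + d" using that S by auto
    then have "b - a < (q - p) + (r - l)" using a that U V by auto
    then show ?thesis unfolding e using S by (simp add: ennreal_lessI)
  qed
qed

section \<open>Linear images of convex corners\<close>

definition comb :: "'i set \<Rightarrow> ('i \<Rightarrow> 'a::real_vector) \<Rightarrow> ('i \<Rightarrow> real) \<Rightarrow> 'a" where
  "comb I W a = (\<Sum>i\<in>I. a i *\<^sub>R W i)"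

text \<open>The functional \<open>f\<close> is meant to satisfy \<open>f (W i) = 1\<close>; the other vectors
are then projected along \<open>W i\<close> into the kernel of \<open>f\<close>.\<close>
definition isolate :: "('a::real_vector \<Rightarrow> real) \<Rightarrow> ('i \<Rightarrow> 'a) \<Rightarrow> 'i \<Rightarrow> 'i \<Rightarrow> 'a" where
  "isolate f W i j = (if j = i then W i else W j - f (W j) *\<^sub>R W i)"

lemma comb_mix: "comb I W (\<lambda>i. s * a i + t * b i) = s *\<^sub>R comb I W a + t *\<^sub>R comb I W b"
  by (simp add: comb_def scaleR_left_distrib sum.distrib scaleR_sum_right)

lemma comb_scale: "comb I W (\<lambda>i. s * a i) = s *\<^sub>R comb I W a"
  by (simp add: comb_def scaleR_sum_right)

lemma comb_cong: "(\<And>j. j \<in> I \<Longrightarrow> W j \<noteq> 0 \<Longrightarrow> a j = b j) \<Longrightarrow> comb I W a = comb I W b"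
  unfolding comb_def by (rule sum.cong) auto

lemma comb_delete:
  assumes "finite I" "i \<in> I"
  shows "comb I W a = a i *\<^sub>R W i + comb I (W(i := 0)) a"
proof -
  have "comb I W' a = a i *\<^sub>R W' i + (\<Sum>j\<in>I - {i}. a j *\<^sub>R W' j)" for W' :: "'a \<Rightarrow> 'b"
    unfolding comb_def using assms by (rule sum.remove)
  moreover have "(\<Sum>j\<in>I - {i}. a j *\<^sub>R (W(i := 0)) j) = (\<Sum>j\<in>I - {i}. a j *\<^sub>R W j)"
    by (rule sum.cong) auto
  ultimately show ?thesis by simp
qed

lemma comb_isolate:
  assumes "finite I" "i \<in> I" "linear f"
  shows "comb I (isolate f W i) a =
    a i *\<^sub>R W i + (comb I (W(i := 0)) a - f (comb I (W(i := 0)) a) *\<^sub>R W i)"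
proof -
  interpret linear f by fact
  have "comb I ((isolate f W i)(i := 0)) a = (\<Sum>j\<in>I. a j *\<^sub>R (W(i := 0)) j - (a j * f ((W(i := 0)) j)) *\<^sub>R W i)"
    unfolding comb_def by (rule sum.cong) (auto simp: isolate_def scaleR_diff_right zero)
  also have "\<dots> = comb I (W(i := 0)) a - f (comb I (W(i := 0)) a) *\<^sub>R W i"
    unfolding comb_def by (simp add: sum_subtractf sum scale scaleR_sum_left del: fun_upd_apply)
  finally show ?thesis
    using comb_delete[OF assms(1,2), of "isolate f W i" a] by (simp add: isolate_def)
qed

lemma convex_fibre:
  assumes "convex A" shows "convex {s::real. x + s *\<^sub>R w \<in> A}"
  unfolding convex_alt
proof safe
  fix s t u :: real assume *: "x + s *\<^sub>R w \<in> A" "x + t *\<^sub>R w \<in> A" "0 \<le> u" "u \<le> 1"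
  have "x + ((1 - u) *\<^sub>R s + u *\<^sub>R t) *\<^sub>R w = (1 - u) *\<^sub>R (x + s *\<^sub>R w) + u *\<^sub>R (x + t *\<^sub>R w)"
    by (simp add: algebra_simps)
  also have "\<dots> \<in> A" using assms * unfolding convex_alt by blast
  finally show "x + ((1 - u) *\<^sub>R s + u *\<^sub>R t) *\<^sub>R w \<in> A" .
qed

lemma compact_fibre:
  fixes A :: "'a::euclidean_space set"
  assumes "compact A" "w \<noteq> 0" shows "compact {s::real. x + s *\<^sub>R w \<in> A}"
proof -
  have "closed ((\<lambda>s. x + s *\<^sub>R w) -` A)"
    using assms by (intro closed_vimage compact_imp_closed) (auto intro!: continuous_intros)
  moreover obtain B where B: "\<And>y. y \<in> A \<Longrightarrow> norm y \<le> B"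
    using compact_imp_bounded[OF assms(1)] unfolding bounded_iff by blast
  have "norm s \<le> (B + norm x) / norm w" if "x + s *\<^sub>R w \<in> A" for s :: real
  proof -
    have "norm (s *\<^sub>R w) \<le> norm (x + s *\<^sub>R w) + norm x" using norm_triangle_ineq4[of "x + s *\<^sub>R w" x] by simp
    then have "\<bar>s\<bar> * norm w \<le> B + norm x" using B[OF that] by simp
    then show ?thesis using assms(2) by (simp add: field_simps)
  qed
  then have "bounded {s::real. x + s *\<^sub>R w \<in> A}" unfolding bounded_iff by blast
  ultimately show ?thesis by (simp add: compact_eq_bounded_closed vimage_def)
qed

lemma convex_spanning_positive_measure:
  fixes A :: "'a::euclidean_space set"
  assumes "compact A" "convex A" "0 \<in> A" "span A = UNIV"
  shows "0 < emeasure lborel A"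
proof (cases "interior A = {}")
  case True
  then obtain a b where ab: "a \<noteq> 0" "A \<subseteq> {x. a \<bullet> x = b}"
    using empty_interior_subset_hyperplane[OF assms(2)] by metis
  with assms(3) have "b = 0" by auto
  with ab have "A \<subseteq> {x. a \<bullet> x = 0}" by simp
  then have "span A \<subseteq> {x. a \<bullet> x = 0}" by (rule span_minimal) (rule subspace_hyperplane)
  with assms(4) have "a \<bullet> a = 0" by blast
  with ab show ?thesis by simp
next
  case False
  then obtain c r where r: "r > 0" "ball c r \<subseteq> A" by (meson all_not_in_conv mem_interior)
  have "0 < emeasure lborel (ball c r)"
    using r by (simp add: emeasure_ball ennreal_zero_less_mult_iff)
  also have "\<dots> \<le> emeasure lborel A"
    using r assms(1) by (intro emeasure_mono) (auto simp: borel_compact)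
  finally show ?thesis .
qed

text \<open>Coefficient vectors are functions on the whole index type that vanish outside the finite set
\<open>I\<close>. In this way the topology of pointwise convergence provides compactness, and the corner does
not change when a vector of the family is deleted or projected.\<close>
locale convex_corner =
  fixes I :: "'i set" and K :: "('i \<Rightarrow> real) set"
  assumes finite_I: "finite I"
    and nonneg: "a \<in> K \<Longrightarrow> 0 \<le> a i"
    and le_one: "a \<in> K \<Longrightarrow> a i \<le> 1"
    and off: "a \<in> K \<Longrightarrow> i \<notin> I \<Longrightarrow> a i = 0"
    and unit: "i \<in> I \<Longrightarrow> (\<lambda>j. if j = i then 1 else 0) \<in> K"
    and zero: "(\<lambda>j. 0) \<in> K"
    and down: "a \<in> K \<Longrightarrow> (\<And>i. 0 \<le> b i) \<Longrightarrow> (\<And>i. b i \<le> a i) \<Longrightarrow> b \<in> K"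
    and mix: "a \<in> K \<Longrightarrow> b \<in> K \<Longrightarrow> 0 \<le> t \<Longrightarrow> t \<le> 1 \<Longrightarrow> (\<lambda>i. (1 - t) * a i + t * b i) \<in> K"
    and compact_K: "compact K"
begin

lemma scale: "a \<in> K \<Longrightarrow> 0 \<le> t \<Longrightarrow> t \<le> 1 \<Longrightarrow> (\<lambda>i. t * a i) \<in> K"
  using mix[OF zero] by simp

lemma cut: "a \<in> K \<Longrightarrow> a(i := 0) \<in> K"
  by (rule down) (auto simp: nonneg)

lemma comb_unit: "i \<in> I \<Longrightarrow> comb I W (\<lambda>j. if j = i then 1 else 0) = W i"
  using finite_I by (simp add: comb_def if_distrib[of "\<lambda>c. c *\<^sub>R _"] cong: if_cong)

lemma compact_comb: "compact (comb I W ` K)" for W :: "'i \<Rightarrow> 'a::real_normed_vector"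
proof -
  have "continuous_on K (\<lambda>a. a i)" for i
    by (rule continuous_on_subset[OF continuous_on_product_coordinates]) simp
  then show ?thesis
    unfolding comb_def by (intro compact_continuous_image compact_K continuous_intros)
qed

lemma convex_comb: "convex (comb I W ` K)"
  unfolding convex_alt
proof safe
  fix a b and t :: real assume *: "a \<in> K" "b \<in> K" "0 \<le> t" "t \<le> 1"
  have "(1 - t) *\<^sub>R comb I W a + t *\<^sub>R comb I W b = comb I W (\<lambda>i. (1 - t) * a i + t * b i)"
    by (simp add: comb_mix)
  then show "(1 - t) *\<^sub>R comb I W a + t *\<^sub>R comb I W b \<in> comb I W ` K"
    using mix[OF *] by simp
qed

lemma span_comb:
  assumes "span (W ` I) = UNIV" shows "span (comb I W ` K) = UNIV"
proof -
  have "W ` I \<subseteq> comb I W ` K"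
  proof
    fix y assume "y \<in> W ` I"
    then obtain i where "i \<in> I" "y = W i" by auto
    then show "y \<in> comb I W ` K" using comb_unit[of i W] unit[of i] by (metis imageI)
  qed
  then have "span (W ` I) \<subseteq> span (comb I W ` K)" by (rule span_mono)
  with assms show ?thesis by auto
qed

lemma zero_comb: "0 \<in> comb I W ` K"
  by (rule image_eqI[OF _ zero]) (simp add: comb_def)

lemma comb_positive_measure:
  fixes W :: "'i \<Rightarrow> 'a::euclidean_space"
  shows "span (W ` I) = UNIV \<Longrightarrow> 0 < emeasure lborel (comb I W ` K)"
  by (intro convex_spanning_positive_measure compact_comb convex_comb zero_comb span_comb)

end

text \<open>The setting of one step of the induction, in which the image of \<open>K\<close> is sliced by the
lines parallel to \<open>W i\<close>. The value \<open>f y\<close> is the height of \<open>y\<close> on its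
line.\<close>
locale corner_step = convex_corner I K for I :: "'i set" and K :: "('i \<Rightarrow> real) set" +
  fixes W :: "'i \<Rightarrow> 'a::euclidean_space" and i :: 'i and f :: "'a \<Rightarrow> real"
  assumes i: "i \<in> I" and linear_f: "linear f" and f_Wi: "f (W i) = 1"
begin

abbreviation W0 where "W0 \<equiv> W(i := 0)"
abbreviation W1 where "W1 \<equiv> isolate f W i"

text \<open>\<open>shadow\<close> identifies the line through a point, and \<open>level x\<close> consists of
the coefficient vectors whose image lies on the line through \<open>x\<close>. This condition does not involve
the coordinate at \<open>i\<close>, which is why one set of coefficients describes the slices of all three
images.\<close>
definition shadow :: "'a \<Rightarrow> 'a" where "shadow x = x - f x *\<^sub>R W i"

definition level :: "'a \<Rightarrow> ('i \<Rightarrow> real) set" where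
  "level x = {a \<in> K. shadow (comb I W0 a) = shadow x}"

abbreviation fibre :: "'a set \<Rightarrow> 'a \<Rightarrow> real set" where
  "fibre A x \<equiv> {s. x + s *\<^sub>R W i \<in> A}"

lemma f_simps: "f (x + y) = f x + f y" "f (x - y) = f x - f y" "f (c *\<^sub>R x) = c * f x"
  using linear_f by (simp_all add: linear_add linear_diff linear_cmul)

lemma on_line_iff:
  "x + s *\<^sub>R W i = r *\<^sub>R W i + y \<longleftrightarrow> shadow y = shadow x \<and> s = r + f y - f x"
proof
  assume *: "x + s *\<^sub>R W i = r *\<^sub>R W i + y"
  then have y: "y = x + (s - r) *\<^sub>R W i" by (simp add: algebra_simps)
  show "shadow y = shadow x \<and> s = r + f y - f x"
    unfolding y shadow_def f_simps f_Wi by (simp add: scaleR_left_distrib scaleR_left_diff_distrib)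
next
  assume *: "shadow y = shadow x \<and> s = r + f y - f x"
  then have y: "y = x - f x *\<^sub>R W i + f y *\<^sub>R W i"
    by (simp add: shadow_def diff_eq_eq)
  from * have s: "s = r + f y - f x" by simp
  show "x + s *\<^sub>R W i = r *\<^sub>R W i + y"
    unfolding s by (subst (2) y) (simp add: scaleR_left_distrib scaleR_left_diff_distrib)
qed

lemma fibre_full: "fibre (comb I W ` K) x = (\<lambda>a. a i + f (comb I W0 a) - f x) ` level x"
proof -
  have "x + s *\<^sub>R W i \<in> comb I W ` K \<longleftrightarrow> (\<exists>a\<in>K. x + s *\<^sub>R W i = a i *\<^sub>R W i + comb I W0 a)" for s
    using comb_delete[OF finite_I i, of W] by auto
  then show ?thesis unfolding on_line_iff level_def by auto
qed

lemma fibre_deleted: "fibre (comb I W0 ` K) x = (\<lambda>a. f (comb I W0 a) - f x) ` level x"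
proof -
  have "x + s *\<^sub>R W i \<in> comb I W0 ` K \<longleftrightarrow> (\<exists>a\<in>K. x + s *\<^sub>R W i = 0 *\<^sub>R W i + comb I W0 a)" for s
    by auto
  then show ?thesis unfolding on_line_iff level_def by auto
qed

lemma fibre_isolated: "fibre (comb I W1 ` K) x = (\<lambda>a. a i - f x) ` level x"
proof -
  have s: "shadow (shadow y) = shadow y" "f (shadow y) = 0" for y
    by (simp_all add: shadow_def f_simps f_Wi)
  have "x + s *\<^sub>R W i \<in> comb I W1 ` K \<longleftrightarrow>
      (\<exists>a\<in>K. x + s *\<^sub>R W i = a i *\<^sub>R W i + shadow (comb I W0 a))" for s
    using comb_isolate[OF finite_I i linear_f, of W] by (auto simp: shadow_def)
  then show ?thesis unfolding on_line_iff level_def by (auto simp: s)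
qed

lemma Wi_nonzero: "W i \<noteq> 0"
  using f_Wi linear_0[OF linear_f] by auto

lemmas fibre_shape = compact_fibre[OF compact_comb Wi_nonzero] convex_fibre[OF convex_comb]

lemma fibre_split:
  "s \<in> fibre (comb I W ` K) x \<Longrightarrow>
    \<exists>u\<in>fibre (comb I W1 ` K) x. \<exists>v\<in>fibre (comb I W0 ` K) x. s = u + v + f x"
  unfolding fibre_full fibre_deleted fibre_isolated by fastforce

lemma fibre_length_le:
  "emeasure lborel (fibre (comb I W ` K) x) \<le>
     emeasure lborel (fibre (comb I W1 ` K) x) + emeasure lborel (fibre (comb I W0 ` K) x)"
proof (cases "level x = {}")
  case True then show ?thesis unfolding fibre_full by simp
next
  case False
  show ?thesis
    by (rule interval_length_subadditive(1)[OF fibre_shape fibre_shape fibre_shape _ _ _ fibre_split])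
      (use False in \<open>simp_all add: fibre_full fibre_deleted fibre_isolated del: mem_Collect_eq\<close>)
qed

text \<open>The assumption concerns the maxima. As for the minima, the minimum of \<open>a i\<close> is zero
and is compatible with every value of \<open>f (comb I W0 a)\<close>, because the coordinate at
\<open>i\<close> may be set to zero in a corner.\<close>
lemma fibre_length_eq:
  assumes "\<And>a b. a \<in> level x \<Longrightarrow> b \<in> level x \<Longrightarrow>
     \<exists>c\<in>level x. a i + f (comb I W0 b) \<le> c i + f (comb I W0 c)"
  shows "emeasure lborel (fibre (comb I W ` K) x) =
     emeasure lborel (fibre (comb I W1 ` K) x) + emeasure lborel (fibre (comb I W0 ` K) x)"
proof (cases "level x = {}")
  case True then show ?thesis unfolding fibre_full fibre_deleted fibre_isolated by simp
next
  case False
  show ?thesis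
  proof (rule interval_length_subadditive(2)[OF fibre_shape fibre_shape fibre_shape _ _ _ fibre_split])
    fix u v assume "u \<in> fibre (comb I W1 ` K) x" "v \<in> fibre (comb I W0 ` K) x"
    then obtain a b where a: "a \<in> level x" "u = a i - f x" and b: "b \<in> level x" "v = f (comb I W0 b) - f x"
      unfolding fibre_deleted fibre_isolated by auto
    obtain c where c: "c \<in> level x" "a i + f (comb I W0 b) \<le> c i + f (comb I W0 c)"
      using assms a b by blast
    have "comb I W0 (b(i := 0)) = comb I W0 b" by (rule comb_cong) auto
    then have b': "b(i := 0) \<in> level x" "f (comb I W0 (b(i := 0))) = f (comb I W0 b)"
      using b cut by (auto simp: level_def)
    have "0 \<le> a i" using a nonneg by (auto simp: level_def)
    then show "(\<exists>s\<in>fibre (comb I W ` K) x. u + v + f x \<le> s) \<and> (\<exists>s\<in>fibre (comb I W ` K) x. s \<le> u + v + f x)"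
      unfolding fibre_full bex_simps(7) using a b c(2) b'(2) 
      by (intro conjI bexI[OF _ c(1)] bexI[OF _ b'(1)]) simp_all
  qed (use False in \<open>simp_all add: fibre_full fibre_deleted fibre_isolated del: mem_Collect_eq\<close>)
qed

abbreviation slab where "slab \<equiv> {x. 0 \<le> f x \<and> f x < 1}"

lemma measure_by_fibres:
  "compact A \<Longrightarrow> emeasure lborel A = (\<integral>\<^sup>+x. indicator slab x * emeasure lborel (fibre A x) \<partial>lborel)"
  by (rule emeasure_eq_slab_integral_of_fibres[OF _ linear_f f_Wi]) (rule borel_compact)

lemma slab_measurable[measurable]: "slab \<in> sets borel"
proof -
  have [measurable]: "f \<in> borel_measurable borel"
    using linear_f by (intro borel_measurable_continuous_onI linear_continuous_on linear_conv_bounded_linear[THEN iffD1])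
  show ?thesis by measurable
qed

lemma fibre_measurable: "compact A \<Longrightarrow> (\<lambda>x. emeasure lborel (fibre A x)) \<in> borel_measurable lborel"
  by (intro fibre_length_measurable borel_compact)

lemma sum_by_fibres:
  "emeasure lborel (comb I W1 ` K) + emeasure lborel (comb I W0 ` K) =
    (\<integral>\<^sup>+x. indicator slab x * (emeasure lborel (fibre (comb I W1 ` K) x) +
        emeasure lborel (fibre (comb I W0 ` K) x)) \<partial>lborel)"
  unfolding measure_by_fibres[OF compact_comb[of W1]] measure_by_fibres[OF compact_comb[of W0]] distrib_left
  by (rule nn_integral_add[symmetric]) 
    (use fibre_measurable[OF compact_comb] slab_measurable in measurable)

lemma step_le:
  "emeasure lborel (comb I W ` K) \<le> emeasure lborel (comb I W1 ` K) + emeasure lborel (comb I W0 ` K)"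
  unfolding sum_by_fibres unfolding measure_by_fibres[OF compact_comb[of W]]
  by (intro nn_integral_mono mult_left_mono fibre_length_le) auto

lemma step_eq:
  assumes "\<And>a b. a \<in> K \<Longrightarrow> b \<in> K \<Longrightarrow> shadow (comb I W0 a) = shadow (comb I W0 b) \<Longrightarrow>
     \<exists>c\<in>K. shadow (comb I W0 c) = shadow (comb I W0 a) \<and> a i + f (comb I W0 b) \<le> c i + f (comb I W0 c)"
  shows "emeasure lborel (comb I W ` K) = emeasure lborel (comb I W1 ` K) + emeasure lborel (comb I W0 ` K)"
proof -
  have "emeasure lborel (fibre (comb I W ` K) x) =
     emeasure lborel (fibre (comb I W1 ` K) x) + emeasure lborel (fibre (comb I W0 ` K) x)" for x
  proof (rule fibre_length_eq)
    fix a b assume "a \<in> level x" "b \<in> level x"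
    with assms[of a b] show "\<exists>c\<in>level x. a i + f (comb I W0 b) \<le> c i + f (comb I W0 c)"
      unfolding level_def by auto
  qed
  then show ?thesis unfolding sum_by_fibres unfolding measure_by_fibres[OF compact_comb[of W]] by simp
qed

end

context corner_step begin
text \<open>Suppose that \<open>W i\<close> points into the cone of the other vectors, and let
\<open>\<gamma>\<close> be the largest height that these reach on the line through the origin. The two maximal
heights on this line add up to the point \<open>z = (1 + \<gamma>) *\<^sub>R W i\<close>. A preimage
\<open>a\<close> of \<open>z\<close> would have \<open>a i = 1\<close>, and its other coordinates would reach
the height \<open>\<gamma>\<close>. But by \<open>face\<close> they can be enlarged, against the maximality of
\<open>\<gamma>\<close>. Hence the image misses \<open>z\<close>, and by compactness a ball around it.

One line has measure zero, so the defect has to be carried to nearby lines. These are the lines that meet the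
image scaled by a small \<open>\<theta>\<close>, which has positive volume. By convexity, the coefficients
that are optimal at the origin can be mixed with a fraction \<open>\<theta>\<close> of those over the given
line, which changes the critical point by little.\<close>
lemma step_less:
  assumes span: "span (W ` I) = UNIV"
    and pos: "c \<in> K" "comb I W0 c = t *\<^sub>R W i" "t > 0"
    and face: "\<And>a. a \<in> K \<Longrightarrow> a i = 1 \<Longrightarrow> \<exists>r>1. (\<lambda>j. r * (a(i := 0)) j) \<in> K"
  shows "emeasure lborel (comb I W ` K) < emeasure lborel (comb I W1 ` K) + emeasure lborel (comb I W0 ` K)"
proof -
  have cut0: "comb I W0 (a(i := 0)) = comb I W0 a" for a by (rule comb_cong) auto
  define G where "G = {s. 0 + s *\<^sub>R W i \<in> comb I W0 ` K}"
  have "compact G" unfolding G_def by (rule fibre_shape)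
  moreover have "t \<in> G" using pos by (auto simp: G_def intro!: image_eqI[of _ _ c])
  ultimately obtain \<gamma> where \<gamma>: "\<gamma> \<in> G" "\<And>s. s \<in> G \<Longrightarrow> s \<le> \<gamma>"
    using compact_attains_sup[of G] by auto
  have "\<gamma> > 0" using \<gamma>(2)[OF \<open>t \<in> G\<close>] pos by simp
  obtain c0 where c0: "c0 \<in> K" "comb I W0 c0 = \<gamma> *\<^sub>R W i" using \<gamma>(1) by (auto simp: G_def)
  define z where "z = (1 + \<gamma>) *\<^sub>R W i"
  have "z \<notin> comb I W ` K"
  proof
    assume "z \<in> comb I W ` K"
    then obtain a where a: "a \<in> K" "z = comb I W a" by auto
    then have "comb I W0 a = (1 + \<gamma> - a i) *\<^sub>R W i"
      using comb_delete[OF finite_I i, of W a] by (simp add: z_def algebra_simps)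
    then have h: "1 + \<gamma> - a i \<in> G" "comb I W0 (a(i := 0)) = (1 + \<gamma> - a i) *\<^sub>R W i"
      using a(1) by (auto simp: G_def cut0 intro!: image_eqI[of _ _ a])
    then have ai: "a i = 1" using \<gamma>(2) le_one[OF a(1), of i] by fastforce
    then obtain r where r: "r > 1" "(\<lambda>j. r * (a(i := 0)) j) \<in> K" using face a(1) by blast
    have "comb I W0 (\<lambda>j. r * (a(i := 0)) j) = (r * \<gamma>) *\<^sub>R W i"
      using comb_scale[of I W0 r "a(i := 0)"] h(2) ai by (simp del: fun_upd_apply)
    then have "r * \<gamma> \<in> G" using r(2) by (auto simp: G_def intro!: image_eqI[of _ _ "\<lambda>j. r * (a(i := 0)) j"] simp del: fun_upd_apply)
    then have "r * \<gamma> \<le> \<gamma>" by (rule \<gamma>)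
    then show False using r \<open>\<gamma> > 0\<close> by simp
  qed
  then obtain \<epsilon> where \<epsilon>: "\<epsilon> > 0" "\<And>y. dist y z < \<epsilon> \<Longrightarrow> y \<notin> comb I W ` K"
    using compact_imp_closed[OF compact_comb, of W] unfolding closed_def open_dist by (meson ComplD ComplI)
  obtain B where B: "\<And>b. b \<in> K \<Longrightarrow> norm (comb I W0 b) \<le> B"
    using compact_imp_bounded[OF compact_comb, of W0] unfolding bounded_iff by blast
  have "0 \<le> B" using B[OF zero] by (rule order_trans[OF norm_ge_zero])
  \<comment> \<open>The point built below is \<open>(1 - \<theta>) *\<^sub>R z + \<theta> *\<^sub>R y\<close> with \<open>norm y \<le> B\<close>; for this \<open>\<theta>\<close> it
    stays in the ball around \<open>z\<close> that the image misses.\<close>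
  define \<theta> where "\<theta> = min 1 (\<epsilon> / (2 * (B + norm z + 1)))"
  have \<theta>: "0 < \<theta>" "\<theta> \<le> 1" "\<theta> * (B + norm z) < \<epsilon>"
  proof -
    have p: "0 < B + norm z + 1" using \<open>0 \<le> B\<close> by (simp add: add_nonneg_pos)
    then show "0 < \<theta>" "\<theta> \<le> 1" using \<epsilon> by (auto simp: \<theta>_def)
    have "\<theta> * (B + norm z) \<le> \<epsilon> / (2 * (B + norm z + 1)) * (B + norm z + 1)"
      using p \<open>0 \<le> B\<close> \<open>0 < \<theta>\<close> by (intro mult_mono) (auto simp: \<theta>_def)
    also have "\<dots> = \<epsilon> / 2" using p by (simp add: field_simps)
    finally show "\<theta> * (B + norm z) < \<epsilon>" using \<epsilon> by simp
  qed
  have outside: "(1 - \<theta>) *\<^sub>R z + \<theta> *\<^sub>R comb I W0 b \<notin> comb I W ` K" if "b \<in> K" for b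
  proof (rule \<epsilon>)
    have "(1 - \<theta>) *\<^sub>R z + \<theta> *\<^sub>R comb I W0 b - z = \<theta> *\<^sub>R (comb I W0 b - z)"
      by (simp add: algebra_simps)
    then have "dist ((1 - \<theta>) *\<^sub>R z + \<theta> *\<^sub>R comb I W0 b) z = \<theta> * norm (comb I W0 b - z)"
      using \<theta> by (simp add: dist_norm)
    also have "\<dots> \<le> \<theta> * (B + norm z)"
      using norm_triangle_ineq4[of "comb I W0 b" z] B[OF that] \<theta> by (intro mult_left_mono) auto
    finally show "dist ((1 - \<theta>) *\<^sub>R z + \<theta> *\<^sub>R comb I W0 b) z < \<epsilon>" using \<theta> by simp
  qed
  define D where "D = (\<lambda>y. \<theta> *\<^sub>R y) ` comb I W ` K"
  have cD: "compact D" unfolding D_def by (intro compact_scaling compact_comb)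
  have less: "emeasure lborel (fibre (comb I W ` K) x) <
      emeasure lborel (fibre (comb I W1 ` K) x) + emeasure lborel (fibre (comb I W0 ` K) x)"
    if "fibre D x \<noteq> {}" for x
  proof -
    from that obtain s0 b0 where s0: "b0 \<in> K" "x + s0 *\<^sub>R W i = \<theta> *\<^sub>R comb I W b0" unfolding D_def by auto
    define b where "b = b0(i := 0)"
    have b: "b \<in> K" "b i = 0" "comb I W0 b = comb I W0 b0" using s0 cut by (auto simp: b_def cut0)
    have "x + s0 *\<^sub>R W i = (\<theta> * b0 i) *\<^sub>R W i + \<theta> *\<^sub>R comb I W0 b"
      using s0 b comb_delete[OF finite_I i, of W b0] by (simp add: algebra_simps)
    then have sh: "shadow (\<theta> *\<^sub>R comb I W0 b) = shadow x" unfolding on_line_iff by simp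
    have shW: "shadow (y + c *\<^sub>R W i) = shadow y" for y c
      by (simp add: shadow_def f_simps f_Wi algebra_simps)
    define g where "g = \<theta> * f (comb I W0 b)"
    define e where "e = (\<lambda>j. if j = i then 1 else 0 :: real)"
    have e: "e \<in> K" "comb I W0 e = 0" unfolding e_def using unit i comb_unit[OF i, of W0] by auto
    \<comment> \<open>\<open>a1\<close> is nearly optimal for the coordinate at \<open>i\<close>, \<open>a2\<close> for the height of the other vectors, and
      \<open>a3\<close> shows that the critical point \<open>?q\<close> lies above some point of the slice.\<close>
    define a1 where "a1 = (\<lambda>j. (1 - \<theta>) * e j + \<theta> * b j)"
    define a2 where "a2 = (\<lambda>j. (1 - \<theta>) * c0 j + \<theta> * b j)"
    define a3 where "a3 = (\<lambda>j. \<theta> * b j)"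
    have "comb I W0 a1 = \<theta> *\<^sub>R comb I W0 b" using e by (simp add: a1_def comb_mix)
    then have a1: "a1 \<in> level x" "a1 i = 1 - \<theta>"
      using mix[OF e(1) b(1), of \<theta>] \<theta> sh b by (simp_all add: level_def a1_def e_def)
    have "comb I W0 a2 = \<theta> *\<^sub>R comb I W0 b + ((1 - \<theta>) * \<gamma>) *\<^sub>R W i" using c0 by (simp add: a2_def comb_mix)
    then have a2: "a2 \<in> level x" "f (comb I W0 a2) = (1 - \<theta>) * \<gamma> + g"
      using mix[OF c0(1) b(1), of \<theta>] \<theta> sh b by (simp_all add: level_def a2_def[symmetric] shW f_simps f_Wi g_def)
    have "comb I W0 a3 = \<theta> *\<^sub>R comb I W0 b" by (simp add: a3_def comb_scale)
    then have a3: "a3 \<in> level x" "f (comb I W0 a3) = g" "a3 i = 0"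
      using scale[OF b(1), of \<theta>] \<theta> sh b by (simp_all add: level_def a3_def[symmetric] g_def f_simps) (simp add: a3_def b)
    have u: "1 - \<theta> - f x \<in> fibre (comb I W1 ` K) x" unfolding fibre_isolated by (rule image_eqI[OF _ a1(1)]) (simp add: a1)
    have v: "(1 - \<theta>) * \<gamma> + g - f x \<in> fibre (comb I W0 ` K) x" unfolding fibre_deleted by (rule image_eqI[OF _ a2(1)]) (simp add: a2)
    have s: "g - f x \<in> fibre (comb I W ` K) x" unfolding fibre_full by (rule image_eqI[OF _ a3(1)]) (simp add: a3)
    let ?q = "(1 - \<theta> - f x) + ((1 - \<theta>) * \<gamma> + g - f x) + f x"
    have "x + ?q *\<^sub>R W i = ((1 - \<theta>) * (1 + \<gamma>)) *\<^sub>R W i + \<theta> *\<^sub>R comb I W0 b"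
      unfolding on_line_iff using sh by (simp add: g_def f_simps algebra_simps)
    then have "x + ?q *\<^sub>R W i = (1 - \<theta>) *\<^sub>R z + \<theta> *\<^sub>R comb I W0 b" by (simp add: z_def)
    then have q: "?q \<notin> fibre (comb I W ` K) x" using outside[OF b(1)] by simp
    have "0 \<le> (1 - \<theta>) * \<gamma>" using \<theta> \<open>\<gamma> > 0\<close> by simp
    then have le: "g - f x \<le> ?q" using \<theta> by linarith
    have ne: "fibre (comb I W ` K) x \<noteq> {}" "fibre (comb I W1 ` K) x \<noteq> {}" "fibre (comb I W0 ` K) x \<noteq> {}"
      using s u v by blast+
    show ?thesis
      by (rule interval_length_subadditive(3)[OF fibre_shape fibre_shape fibre_shape ne fibre_split u v q s le])
  qed
  have "span D = UNIV"
  proof -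
    have "comb I W ` K \<subseteq> span D"
    proof
      fix y assume "y \<in> comb I W ` K"
      then have "inverse \<theta> *\<^sub>R \<theta> *\<^sub>R y \<in> span D" unfolding D_def by (intro span_scale span_base) auto
      then show "y \<in> span D" using \<theta> by simp
    qed
    then show ?thesis using span_comb[OF span] by (metis span_mono span_span top.extremum_uniqueI)
  qed
  then have "0 < emeasure lborel D"
    using zero_comb[of W] cD unfolding D_def
    by (intro convex_spanning_positive_measure convex_scaling convex_comb) auto
  have "\<not> (AE x in lborel. indicator slab x * (emeasure lborel (fibre (comb I W1 ` K) x) +
        emeasure lborel (fibre (comb I W0 ` K) x)) \<le> indicator slab x * emeasure lborel (fibre (comb I W ` K) x))"
    (is "\<not> (AE x in lborel. ?R x \<le> ?L x)")
  proof
    assume "AE x in lborel. ?R x \<le> ?L x"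
    then have "AE x in lborel. indicator slab x * emeasure lborel (fibre D x) = 0"
    proof (rule AE_mp, intro AE_I2 impI)
      fix x assume *: "?R x \<le> ?L x"
      show "indicator slab x * emeasure lborel (fibre D x) = 0"
      proof (cases "x \<in> slab")
        case True
        with * have "\<not> emeasure lborel (fibre (comb I W ` K) x) <
            emeasure lborel (fibre (comb I W1 ` K) x) + emeasure lborel (fibre (comb I W0 ` K) x)"
          by (simp add: not_less)
        then have "fibre D x = {}" using less[of x] by blast
        then show ?thesis by (simp del: Collect_empty_eq)
      qed simp
    qed
    then have "emeasure lborel D = 0"
      unfolding measure_by_fibres[OF cD]
      by (subst nn_integral_0_iff_AE) (use fibre_measurable[OF cD] slab_measurable in measurable)
    then show False using \<open>0 < emeasure lborel D\<close> by simp
  qed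
  moreover have "(\<integral>\<^sup>+x. ?L x \<partial>lborel) \<noteq> \<infinity>"
    unfolding measure_by_fibres[OF compact_comb, symmetric]
    using emeasure_compact_finite[OF compact_comb, of W] by simp
  ultimately show ?thesis
    unfolding sum_by_fibres unfolding measure_by_fibres[OF compact_comb[of W]]
    by (intro nn_integral_less AE_I2 mult_left_mono fibre_length_le)
      (use fibre_measurable[OF compact_comb] slab_measurable in measurable)
qed

end

section \<open>Orlicz functions\<close>

text \<open>The part in the positive orthant of the polar of the Orlicz ball \<open>{x. \<Sum>i\<in>I. \<phi>
(x i) \<le> 1}\<close>. It is the zonotope of the standard basis of the space of coefficient vectors; for the
identity function it is the unit cube.\<close>
definition orlicz_corner :: "(real \<Rightarrow> real) \<Rightarrow> 'i set \<Rightarrow> ('i \<Rightarrow> real) set" where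
  "orlicz_corner \<phi> I = {a. (\<forall>i. 0 \<le> a i) \<and> (\<forall>i. i \<notin> I \<longrightarrow> a i = 0) \<and>
     (\<forall>x. (\<forall>i\<in>I. 0 \<le> x i) \<and> (\<Sum>i\<in>I. \<phi> (x i)) \<le> 1 \<longrightarrow> (\<Sum>i\<in>I. a i * x i) \<le> 1)}"

lemma orlicz_corner_I:
  assumes "\<And>i. 0 \<le> a i" "\<And>i. i \<notin> I \<Longrightarrow> a i = 0"
    "\<And>x. (\<And>i. i \<in> I \<Longrightarrow> 0 \<le> x i) \<Longrightarrow> (\<Sum>i\<in>I. \<phi> (x i)) \<le> 1 \<Longrightarrow> (\<Sum>i\<in>I. a i * x i) \<le> 1"
  shows "a \<in> orlicz_corner \<phi> I"
  using assms by (auto simp: orlicz_corner_def)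

lemma orlicz_corner_D:
  assumes "a \<in> orlicz_corner \<phi> I"
  shows "0 \<le> a i" "i \<notin> I \<Longrightarrow> a i = 0"
    "(\<And>i. i \<in> I \<Longrightarrow> 0 \<le> x i) \<Longrightarrow> (\<Sum>i\<in>I. \<phi> (x i)) \<le> 1 \<Longrightarrow> (\<Sum>i\<in>I. a i * x i) \<le> 1"
  using assms by (auto simp: orlicz_corner_def)

context
  fixes \<phi> :: "real \<Rightarrow> real"
  assumes orl: "\<phi> \<in> orlicz_class"
begin

lemma phi_zero: "\<phi> 0 = 0" and phi_one: "\<phi> 1 = 1"
  and phi_nonneg: "0 \<le> x \<Longrightarrow> 0 \<le> \<phi> x"
  and phi_convex: "convex_on {0..} \<phi>"
  and phi_less: "0 \<le> x \<Longrightarrow> x < y \<Longrightarrow> \<phi> x < \<phi> y"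
  using orl by (auto simp: orlicz_class_def strict_mono_on_def)

lemma phi_le: "0 \<le> x \<Longrightarrow> x \<le> y \<Longrightarrow> \<phi> x \<le> \<phi> y"
  using phi_less[of x y] by (cases "x = y") auto

lemma phi_mix: "0 \<le> x \<Longrightarrow> 0 \<le> y \<Longrightarrow> 0 \<le> t \<Longrightarrow> t \<le> 1 \<Longrightarrow> \<phi> ((1 - t) * x + t * y) \<le> (1 - t) * \<phi> x + t * \<phi> y"
  using convex_onD[OF phi_convex, of t x y] by simp

lemma phi_scale: "0 \<le> y \<Longrightarrow> 0 \<le> t \<Longrightarrow> t \<le> 1 \<Longrightarrow> \<phi> (t * y) \<le> t * \<phi> y"
  using phi_mix[of 0 y t] phi_zero by simp

lemma phi_le_self: "0 \<le> t \<Longrightarrow> t \<le> 1 \<Longrightarrow> \<phi> t \<le> t"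
  using phi_scale[of 1 t] phi_one by simp

lemma feasible_le_one:
  assumes "finite I" "\<And>i. i \<in> I \<Longrightarrow> 0 \<le> x i" "(\<Sum>i\<in>I. \<phi> (x i)) \<le> 1" "i \<in> I"
  shows "x i \<le> 1"
proof (rule ccontr)
  assume "\<not> x i \<le> 1"
  then have "1 < \<phi> (x i)" using phi_less[of 1 "x i"] phi_one by simp
  also have "\<phi> (x i) \<le> (\<Sum>i\<in>I. \<phi> (x i))"
    using assms phi_nonneg by (intro member_le_sum) auto
  finally show False using assms by simp
qed

text \<open>The slope \<open>D\<close> is the left derivative at \<open>x\<close>, as the supremum of the
slopes of the chords that end there; convexity bounds these by the slopes of all chords to the right of
\<open>x\<close>.\<close>
lemma phi_subgradient:
  assumes "0 < x"
  shows "\<exists>D>0. \<forall>y\<ge>0. \<phi> x + D * (y - x) \<le> \<phi> y"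
proof -
  define q where "q = (\<lambda>y. (\<phi> x - \<phi> y) / (x - y))"
  have sl: "q s \<le> q y" if "0 \<le> s" "s < x" "x < y" for s y
  proof -
    define t where "t = (x - s) / (y - s)"
    have "t * (y - s) = x - s" using that by (simp add: t_def)
    moreover have "(1 - t) * s + t * y = s + t * (y - s)" by (simp add: algebra_simps)
    ultimately have t: "0 \<le> t" "t \<le> 1" "(1 - t) * s + t * y = x" using that
      by (simp_all add: t_def)
    have "\<phi> x \<le> (1 - t) * \<phi> s + t * \<phi> y" using phi_mix[of s y t] t that by simp
    then have "(y - s) * \<phi> x \<le> (y - s) * ((1 - t) * \<phi> s + t * \<phi> y)" using that by (intro mult_left_mono) auto
    also have "\<dots> = ((y - s) - t * (y - s)) * \<phi> s + t * (y - s) * \<phi> y"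
      by (simp add: algebra_simps)
    also have "\<dots> = (y - x) * \<phi> s + (x - s) * \<phi> y"
      unfolding \<open>t * (y - s) = x - s\<close> by simp
    finally have "(\<phi> x - \<phi> s) * (y - x) \<le> (\<phi> y - \<phi> x) * (x - s)" by (simp add: algebra_simps)
    moreover have "q y = (\<phi> y - \<phi> x) / (y - x)" unfolding q_def by (metis minus_diff_eq minus_divide_divide)
    ultimately show ?thesis using that by (simp add: q_def field_simps)
  qed
  have bdd: "bdd_above (q ` {0..<x})"
    using sl[of _ "x + 1"] by (intro bdd_aboveI2[of _ _ "q (x + 1)"]) auto
  define D where "D = (SUP s\<in>{0..<x}. q s)"
  have up: "q s \<le> D" if "0 \<le> s" "s < x" for s
    unfolding D_def using bdd that by (intro cSUP_upper) auto
  have low: "D \<le> q y" if "x < y" for y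
    unfolding D_def using sl that assms by (intro cSUP_least) auto
  have "0 < q 0" using phi_less[of 0 x] assms phi_zero by (simp add: q_def)
  then have "0 < D" using up[of 0] assms by simp
  moreover have "\<phi> x + D * (y - x) \<le> \<phi> y" if "0 \<le> y" for y
  proof (cases y x rule: linorder_cases)
    case less
    then show ?thesis using up[of y] that by (simp add: q_def field_simps)
  next
    case greater
    then have "D * (y - x) \<le> q y * (y - x)" using low[of y] by (intro mult_right_mono) auto
    also have "q y * (y - x) = \<phi> y - \<phi> x"
      using greater by (simp add: q_def field_simps)
    finally show ?thesis by simp
  qed simp
  ultimately show ?thesis by blast
qed

lemma phi_continuous: "continuous_on {0..} \<phi>"
proof -
  have "continuous_on {0<..} \<phi>"
    by (rule convex_on_continuous) (auto intro: convex_on_subset[OF phi_convex])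
  then have "continuous (at x within {0..}) \<phi>" if "0 < x" for x
    using that by (meson continuous_at_imp_continuous_within continuous_on_eq_continuous_at greaterThan_iff open_greaterThan)
  moreover have "continuous (at 0 within {0..}) \<phi>"
  proof -
    have "(\<phi> \<longlongrightarrow> 0) (at 0 within {0..})"
    proof (rule tendsto_sandwich[of "\<lambda>_. 0" \<phi> _ "\<lambda>t. t"])
      show "\<forall>\<^sub>F t in at 0 within {0..}. 0 \<le> \<phi> t"
        by (auto simp: eventually_at_filter phi_nonneg)
      show "\<forall>\<^sub>F t in at 0 within {0..}. \<phi> t \<le> t"
        using phi_le_self unfolding eventually_at by (intro exI[of _ 1]) (auto simp: dist_real_def)
    qed (auto intro!: tendsto_eq_intros)
    then show ?thesis by (simp add: continuous_within phi_zero)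
  qed
  ultimately show ?thesis
    unfolding continuous_on_eq_continuous_within by (metis atLeast_iff less_eq_real_def)
qed

end

lemma identity_orlicz: "(\<lambda>t. t) \<in> orlicz_class"
  by (auto simp: orlicz_class_def strict_mono_on_def convex_on_def)

section \<open>Orlicz corners and duality\<close>

lemma sum_over_injection:
  assumes "finite I" "inj_on \<sigma> J" "\<sigma> ` J \<subseteq> I" "\<And>i. i \<in> I - \<sigma> ` J \<Longrightarrow> F i = (0::'c::comm_monoid_add)"
  shows "sum F I = (\<Sum>j\<in>J. F (\<sigma> j))"
proof -
  have "sum F I = sum F (\<sigma> ` J)" using assms by (intro sum.mono_neutral_right) auto
  also have "\<dots> = (\<Sum>j\<in>J. F (\<sigma> j))" using assms(2) by (simp add: sum.reindex)
  finally show ?thesis .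
qed

context
  fixes \<phi> :: "real \<Rightarrow> real"
  assumes orl: "\<phi> \<in> orlicz_class"
begin

lemma orlicz_corner_le_one:
  assumes "finite I" "a \<in> orlicz_corner \<phi> I"
  shows "a i \<le> 1"
proof (cases "i \<in> I")
  case True
  have "(\<Sum>j\<in>I. a j * (if j = i then 1 else 0)) \<le> 1"
    using assms True phi_zero[OF orl] phi_one[OF orl]
    by (intro orlicz_corner_D(3)[OF assms(2)]) (auto simp: if_distrib[of \<phi>] cong: if_cong)
  then show ?thesis using assms True by (simp add: if_distrib cong: if_cong)
next
  case False
  then show ?thesis using orlicz_corner_D(2)[OF assms(2)] by simp
qed

lemma small_in_orlicz_corner:
  assumes "finite I" "\<And>i. 0 \<le> a i" "\<And>i. i \<notin> I \<Longrightarrow> a i = 0" "sum a I \<le> 1"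
  shows "a \<in> orlicz_corner \<phi> I"
proof (rule orlicz_corner_I)
  fix x assume x: "\<And>i. i \<in> I \<Longrightarrow> 0 \<le> x i" "(\<Sum>i\<in>I. \<phi> (x i)) \<le> 1"
  have "(\<Sum>i\<in>I. a i * x i) \<le> (\<Sum>i\<in>I. a i)"
    using assms feasible_le_one[OF orl assms(1) x] by (intro sum_mono) (auto intro: mult_left_le)
  with assms show "(\<Sum>i\<in>I. a i * x i) \<le> 1" by simp
qed (use assms in auto)

lemma compact_orlicz_corner:
  assumes "finite I" shows "compact (orlicz_corner \<phi> I)"
proof -
  have c: "continuous_on UNIV (\<lambda>a::'a \<Rightarrow> real. a i)" for i by simp
  have "orlicz_corner \<phi> I = {a. \<forall>i. 0 \<le> a i} \<inter> {a. \<forall>i. i \<notin> I \<longrightarrow> a i = 0} \<inter>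
     {a. \<forall>x. (\<forall>i\<in>I. 0 \<le> x i) \<and> (\<Sum>i\<in>I. \<phi> (x i)) \<le> 1 \<longrightarrow> (\<Sum>i\<in>I. a i * x i) \<le> 1}"
    by (auto simp: orlicz_corner_def)
  moreover have "closed \<dots>"
    by (intro closed_Int closed_Collect_all closed_Collect_imp closed_Collect_le closed_Collect_eq
        open_Collect_const continuous_intros c)
  ultimately have "closed (orlicz_corner \<phi> I)" by simp
  moreover have "compact (PiE UNIV (\<lambda>_::'a. {0..1::real}))"
    using compactin_PiE[of "\<lambda>_. euclidean :: real topology" UNIV "\<lambda>_::'a. {0..1}"]
    by (simp add: euclidean_product_topology)
  moreover have "orlicz_corner \<phi> I \<subseteq> PiE UNIV (\<lambda>_. {0..1})"
    using orlicz_corner_le_one[OF assms] orlicz_corner_D(1) by (auto simp: PiE_iff)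
  ultimately show ?thesis by (metis compact_Int_closed inf.absorb2)
qed

lemma convex_corner_orlicz:
  assumes I: "finite I" shows "convex_corner I (orlicz_corner \<phi> I)"
proof
  show "finite I" by fact
  fix a assume a: "a \<in> orlicz_corner \<phi> I"
  show "0 \<le> a i" for i using orlicz_corner_D(1)[OF a] .
  show "a i \<le> 1" for i using orlicz_corner_le_one[OF I a] .
  show "a i = 0" if "i \<notin> I" for i using orlicz_corner_D(2)[OF a that] .
  show "b \<in> orlicz_corner \<phi> I" if b: "\<And>i. 0 \<le> b i" "\<And>i. b i \<le> a i" for b
  proof (rule orlicz_corner_I)
    show "b i = 0" if "i \<notin> I" for i
      using b(1)[of i] b(2)[of i] orlicz_corner_D(2)[OF a that] by simp
    fix x assume x: "\<And>i. i \<in> I \<Longrightarrow> 0 \<le> x i" "(\<Sum>i\<in>I. \<phi> (x i)) \<le> 1"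
    have "(\<Sum>i\<in>I. b i * x i) \<le> (\<Sum>i\<in>I. a i * x i)"
      using x b by (intro sum_mono mult_right_mono) auto
    also have "\<dots> \<le> 1" by (rule orlicz_corner_D(3)[OF a x])
    finally show "(\<Sum>i\<in>I. b i * x i) \<le> 1" .
  qed (use b in auto)
  show "(\<lambda>i. (1 - t) * a i + t * b i) \<in> orlicz_corner \<phi> I"
    if b: "b \<in> orlicz_corner \<phi> I" and t: "0 \<le> t" "t \<le> 1" for b and t :: real
  proof (rule orlicz_corner_I)
    fix x assume x: "\<And>i. i \<in> I \<Longrightarrow> 0 \<le> x i" "(\<Sum>i\<in>I. \<phi> (x i)) \<le> 1"
    have "(\<Sum>i\<in>I. ((1 - t) * a i + t * b i) * x i) = (1 - t) * (\<Sum>i\<in>I. a i * x i) + t * (\<Sum>i\<in>I. b i * x i)"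
      by (simp add: algebra_simps sum.distrib sum_subtractf sum_distrib_left)
    also have "\<dots> \<le> (1 - t) * 1 + t * 1"
      using t orlicz_corner_D(3)[OF a x] orlicz_corner_D(3)[OF b x] by (intro add_mono mult_left_mono) auto
    finally show "(\<Sum>i\<in>I. ((1 - t) * a i + t * b i) * x i) \<le> 1" by simp
  qed (use t orlicz_corner_D[OF a] orlicz_corner_D[OF b] in auto)
next
  show "(\<lambda>j. if j = i then 1 else 0) \<in> orlicz_corner \<phi> I" if "i \<in> I" for i
    using I that by (intro small_in_orlicz_corner) auto
  show "(\<lambda>j. 0) \<in> orlicz_corner \<phi> I" using I by (intro small_in_orlicz_corner) auto
  show "compact (orlicz_corner \<phi> I)" by (rule compact_orlicz_corner) fact
qed

text \<open>Since \<open>\<phi> (1/2) < 1/2\<close>, some \<open>t = (1 + s) / 2\<close> above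
\<open>1/2\<close> still has \<open>\<phi> t \<le> 1/2\<close>. If \<open>x\<close> is feasible, then so is
the vector with entry \<open>t\<close> at \<open>i\<close> and \<open>x j / 2\<close> elsewhere. Pairing it
with \<open>a\<close> leaves at most \<open>1 - s\<close> for the pairing of \<open>x\<close> with the other
coordinates of \<open>a\<close>, so these can be enlarged by the factor \<open>1 / (1 - s)\<close>.\<close>
lemma orlicz_corner_face:
  assumes I: "finite I" and half: "\<phi> (1 / 2) < 1 / 2" and i: "i \<in> I"
    and a: "a \<in> orlicz_corner \<phi> I" "a i = 1"
  shows "\<exists>r>1. (\<lambda>j. r * (a(i := 0)) j) \<in> orlicz_corner \<phi> I"
proof -
  \<comment> \<open>This \<open>s\<close> makes the chord of \<open>\<phi>\<close> over \<open>[1/2, 1]\<close> take the value \<open>1/2\<close> at \<open>(1 + s) / 2\<close>.\<close>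
  define s where "s = (1 / 2 - \<phi> (1 / 2)) / (1 - \<phi> (1 / 2))"
  have "0 \<le> \<phi> (1 / 2)" by (rule phi_nonneg[OF orl]) simp
  then have s: "0 < s" "s < 1" using half by (auto simp: s_def field_simps)
  have "(1 - \<phi> (1 / 2)) * s = 1 / 2 - \<phi> (1 / 2)" using half by (simp add: s_def)
  then have "(1 - s) * \<phi> (1 / 2) + s = 1 / 2" by (simp add: algebra_simps)
  moreover have mid: "(1 - s) * (1 / 2) + s * 1 = (1 + s) / 2" by (simp add: field_simps)
  have "\<phi> ((1 + s) / 2) \<le> (1 - s) * \<phi> (1 / 2) + s * \<phi> 1"
    using s by (subst mid[symmetric], intro phi_mix[OF orl]) auto
  ultimately have t: "\<phi> ((1 + s) / 2) \<le> 1 / 2" by (simp add: phi_one[OF orl])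
  have "(\<lambda>j. inverse (1 - s) * (a(i := 0)) j) \<in> orlicz_corner \<phi> I"
  proof (rule orlicz_corner_I)
    fix x assume x: "\<And>i. i \<in> I \<Longrightarrow> 0 \<le> x i" "(\<Sum>i\<in>I. \<phi> (x i)) \<le> 1"
    define y where "y = (\<lambda>j. if j = i then (1 + s) / 2 else x j / 2)"
    have "(\<Sum>j\<in>I. \<phi> (y j)) = \<phi> ((1 + s) / 2) + (\<Sum>j\<in>I - {i}. \<phi> (x j / 2))"
      using I i by (subst sum.remove[OF I i]) (simp add: y_def)
    also have "(\<Sum>j\<in>I - {i}. \<phi> (x j / 2)) \<le> (\<Sum>j\<in>I - {i}. \<phi> (x j) / 2)"
      using x phi_scale[OF orl, of _ "1/2"] by (intro sum_mono) auto
    also have "\<dots> \<le> (\<Sum>j\<in>I. \<phi> (x j)) / 2"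
      unfolding sum_divide_distrib using I x phi_nonneg[OF orl] by (intro sum_mono2) auto
    finally have "(\<Sum>j\<in>I. \<phi> (y j)) \<le> 1" using t x by simp
    then have "(\<Sum>j\<in>I. a j * y j) \<le> 1"
      using x s by (intro orlicz_corner_D(3)[OF a(1)]) (auto simp: y_def)
    also have "(\<Sum>j\<in>I. a j * y j) = (1 + s) / 2 + (\<Sum>j\<in>I - {i}. a j * x j) / 2"
      using a by (subst sum.remove[OF I i]) (simp add: y_def sum_divide_distrib)
    finally have *: "(\<Sum>j\<in>I - {i}. a j * x j) \<le> 1 - s" by (simp add: field_simps)
    have "(\<Sum>j\<in>I. inverse (1 - s) * (a(i := 0)) j * x j) = inverse (1 - s) * (\<Sum>j\<in>I - {i}. a j * x j)"
      by (subst sum.remove[OF I i]) (simp add: sum_distrib_left mult.assoc)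
    also have "\<dots> \<le> inverse (1 - s) * (1 - s)" using * s by (intro mult_left_mono) auto
    finally show "(\<Sum>j\<in>I. inverse (1 - s) * (a(i := 0)) j * x j) \<le> 1" using s by simp
  qed (use s orlicz_corner_D[OF a(1)] in auto)
  moreover have "1 < inverse (1 - s)" using s by (simp add: one_less_inverse)
  ultimately show ?thesis by blast
qed

lemma orlicz_corner_pullback:
  assumes I: "finite I" "inj_on \<sigma> J" "\<sigma> ` J \<subseteq> I" and a: "a \<in> orlicz_corner \<phi> I"
  shows "(\<lambda>j. if j \<in> J then a (\<sigma> j) else 0) \<in> orlicz_corner \<phi> J"
proof (rule orlicz_corner_I)
  fix x assume x: "\<And>j. j \<in> J \<Longrightarrow> 0 \<le> x j" "(\<Sum>j\<in>J. \<phi> (x j)) \<le> 1"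
  define y where "y = (\<lambda>i. if i \<in> \<sigma> ` J then x (inv_into J \<sigma> i) else 0)"
  have y: "y (\<sigma> j) = x j" if "j \<in> J" for j using that I(2) by (simp add: y_def)
  have "(\<Sum>i\<in>I. \<phi> (y i)) = (\<Sum>j\<in>J. \<phi> (y (\<sigma> j)))"
    by (rule sum_over_injection[OF I]) (auto simp: y_def phi_zero[OF orl])
  also have "\<dots> \<le> 1" using x y by simp
  finally have "(\<Sum>i\<in>I. a i * y i) \<le> 1"
    using x(1) by (intro orlicz_corner_D(3)[OF a]) (auto simp: y_def inv_into_into)
  also have "(\<Sum>i\<in>I. a i * y i) = (\<Sum>j\<in>J. a (\<sigma> j) * y (\<sigma> j))"
    by (rule sum_over_injection[OF I]) (auto simp: y_def)
  finally show "(\<Sum>j\<in>J. (if j \<in> J then a (\<sigma> j) else 0) * x j) \<le> 1" using y by (simp cong: sum.cong)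
qed (use orlicz_corner_D[OF a] in auto)

lemma orlicz_corner_pushforward:
  assumes I: "finite I" "inj_on \<sigma> J" "\<sigma> ` J \<subseteq> I" and b: "b \<in> orlicz_corner \<phi> J"
  shows "(\<lambda>i. if i \<in> \<sigma> ` J then b (inv_into J \<sigma> i) else 0) \<in> orlicz_corner \<phi> I"
proof (rule orlicz_corner_I)
  fix x assume x: "\<And>i. i \<in> I \<Longrightarrow> 0 \<le> x i" "(\<Sum>i\<in>I. \<phi> (x i)) \<le> 1"
  have "(\<Sum>j\<in>J. \<phi> (x (\<sigma> j))) = sum (\<lambda>i. \<phi> (x i)) (\<sigma> ` J)" using I(2) by (simp add: sum.reindex)
  also have "\<dots> \<le> (\<Sum>i\<in>I. \<phi> (x i))" using I x phi_nonneg[OF orl] by (intro sum_mono2) auto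
  finally have "(\<Sum>j\<in>J. b j * x (\<sigma> j)) \<le> 1"
    using x I by (intro orlicz_corner_D(3)[OF b]) auto
  moreover have "(\<Sum>i\<in>I. (if i \<in> \<sigma> ` J then b (inv_into J \<sigma> i) else 0) * x i) =
    (\<Sum>j\<in>J. (if \<sigma> j \<in> \<sigma> ` J then b (inv_into J \<sigma> (\<sigma> j)) else 0) * x (\<sigma> j))"
    by (rule sum_over_injection[OF I]) auto
  moreover have "\<dots> = (\<Sum>j\<in>J. b j * x (\<sigma> j))" using I(2) by (intro sum.cong) auto
  ultimately show "(\<Sum>i\<in>I. (if i \<in> \<sigma> ` J then b (inv_into J \<sigma> i) else 0) * x i) \<le> 1" by simp
next
  show "(if i \<in> \<sigma> ` J then b (inv_into J \<sigma> i) else 0) = 0" if "i \<notin> I" for i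
    using that I(3) by auto
qed (use orlicz_corner_D[OF b] in auto)

lemma orlicz_norm_attained:
  assumes I: "finite I" and pos: "i \<in> I" "0 < z i" and nonneg: "\<And>i. 0 \<le> z i"
  shows "\<exists>l>0. (\<Sum>i\<in>I. \<phi> (z i / l)) = 1"
proof -
  define G where "G = (\<lambda>t. \<Sum>i\<in>I. \<phi> (t * z i))"
  have "continuous_on {0..1 / z i} G"
    unfolding G_def using nonneg
    by (intro continuous_on_sum continuous_on_compose2[OF phi_continuous[OF orl]] continuous_intros) auto
  moreover have "G 0 \<le> 1" by (simp add: G_def phi_zero[OF orl])
  moreover have "1 \<le> G (1 / z i)"
  proof -
    have "1 = \<phi> (1 / z i * z i)" using pos phi_one[OF orl] by simp
    also have "\<dots> \<le> G (1 / z i)"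
      unfolding G_def using I pos nonneg by (intro member_le_sum) (auto intro!: phi_nonneg[OF orl])
    finally show ?thesis .
  qed
  ultimately obtain t where t: "0 \<le> t" "t \<le> 1 / z i" "G t = 1"
    using IVT'[of G 0 1 "1 / z i"] pos by auto
  moreover have "t \<noteq> 0" using t(3) by (auto simp: G_def phi_zero[OF orl])
  ultimately show ?thesis
    by (intro exI[of _ "1 / t"]) (simp add: G_def field_simps)
qed

lemma orlicz_norm_eq_Inf:
  assumes I: "finite I" and nonneg: "\<And>i. 0 \<le> z i" and l: "l > 0" "(\<Sum>i\<in>I. \<phi> (z i / l)) = 1"
  shows "{l. l > 0 \<and> (\<Sum>i\<in>I. \<phi> (z i / l)) \<le> 1} = {l..}"
proof safe
  fix m :: real assume m: "m > 0" "(\<Sum>i\<in>I. \<phi> (z i / m)) \<le> 1"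
  have "\<exists>i\<in>I. z i > 0"
  proof (rule ccontr)
    assume "\<not> (\<exists>i\<in>I. z i > 0)"
    then have "z i = 0" if "i \<in> I" for i using nonneg[of i] that by force
    then show False using l by (simp add: phi_zero[OF orl])
  qed
  then obtain k where k: "k \<in> I" "z k > 0" by blast
  show "m \<ge> l"
  proof (rule ccontr)
    assume "\<not> m \<ge> l"
    then have ml: "m < l" by simp
    have "(\<Sum>i\<in>I. \<phi> (z i / l)) < (\<Sum>i\<in>I. \<phi> (z i / m))"
    proof (rule sum_strict_mono_ex1[OF I])
      show "\<forall>i\<in>I. \<phi> (z i / l) \<le> \<phi> (z i / m)"
        using ml m nonneg l by (intro ballI phi_le[OF orl] divide_left_mono) auto
      show "\<exists>i\<in>I. \<phi> (z i / l) < \<phi> (z i / m)"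
        using ml m k l by (intro bexI[of _ k] phi_less[OF orl] divide_strict_left_mono) auto
    qed
    then show False using m l by simp
  qed
next
  fix m assume m: "l \<le> m"
  then show "m > 0" using l by simp
  have "(\<Sum>i\<in>I. \<phi> (z i / m)) \<le> (\<Sum>i\<in>I. \<phi> (z i / l))"
    using m nonneg l by (intro sum_mono phi_le[OF orl] divide_left_mono) auto
  then show "(\<Sum>i\<in>I. \<phi> (z i / m)) \<le> 1" using l by simp
qed

text \<open>The Lagrange condition at a point \<open>x\<close> of the boundary of the Orlicz ball: a vector of
subgradients of \<open>\<phi>\<close> at the entries of \<open>x\<close>, scaled so that its product with
\<open>x\<close> is one. Adding the subgradient inequalities over \<open>I\<close> shows that it belongs to
the corner. The subgradient zero is taken where \<open>x i = 0\<close>.\<close>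
lemma orlicz_corner_dual_point:
  assumes I: "finite I" and x: "\<And>i. 0 \<le> x i" "(\<Sum>i\<in>I. \<phi> (x i)) = 1"
  shows "\<exists>a\<in>orlicz_corner \<phi> I. (\<Sum>i\<in>I. a i * x i) = 1 \<and> (\<forall>i. x i = 0 \<longrightarrow> a i = 0)"
proof -
  have "\<exists>D. (0 < x i \<longrightarrow> 0 < D) \<and> (x i = 0 \<longrightarrow> D = 0) \<and> (\<forall>y\<ge>0. \<phi> (x i) + D * (y - x i) \<le> \<phi> y)" for i
    using phi_subgradient[OF orl, of "x i"] phi_zero[OF orl] phi_nonneg[OF orl] x(1)[of i]
    by (cases "x i = 0") (auto intro!: exI[of _ 0])
  then obtain D where D: "\<And>i. 0 < x i \<Longrightarrow> 0 < D i" "\<And>i. x i = 0 \<Longrightarrow> D i = 0"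
      "\<And>i y. 0 \<le> y \<Longrightarrow> \<phi> (x i) + D i * (y - x i) \<le> \<phi> y" by metis
  have D0: "0 \<le> D i" for i using D(1)[of i] D(2)[of i] x(1)[of i] by (cases "x i = 0") auto
  define S where "S = (\<Sum>i\<in>I. D i * x i)"
  have "\<exists>i\<in>I. x i \<noteq> 0"
  proof (rule ccontr)
    assume "\<not> (\<exists>i\<in>I. x i \<noteq> 0)"
    then show False using x(2) by (simp add: phi_zero[OF orl])
  qed
  then obtain k where k: "k \<in> I" "0 < x k" using x(1) by (metis less_eq_real_def)
  have "0 < D k * x k" using k D by simp
  also have "\<dots> \<le> S" unfolding S_def using I k D0 x by (intro member_le_sum) auto
  finally have S: "0 < S" .
  have "(\<lambda>i. if i \<in> I then D i / S else 0) \<in> orlicz_corner \<phi> I"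
  proof (rule orlicz_corner_I)
    fix y assume y: "\<And>i. i \<in> I \<Longrightarrow> 0 \<le> y i" "(\<Sum>i\<in>I. \<phi> (y i)) \<le> 1"
    have "(\<Sum>i\<in>I. \<phi> (x i) + D i * (y i - x i)) \<le> (\<Sum>i\<in>I. \<phi> (y i))"
      using D y by (intro sum_mono) auto
    then have "(\<Sum>i\<in>I. D i * y i) \<le> S"
      using y x by (simp add: sum.distrib algebra_simps sum_subtractf S_def)
    moreover have "(\<Sum>i\<in>I. (if i \<in> I then D i / S else 0) * y i) = (\<Sum>i\<in>I. D i * y i) / S"
      by (simp add: sum_divide_distrib)
    ultimately show "(\<Sum>i\<in>I. (if i \<in> I then D i / S else 0) * y i) \<le> 1" using S by simp
  qed (use D0 S in auto)
  moreover have "(\<Sum>i\<in>I. (if i \<in> I then D i / S else 0) * x i) = (\<Sum>i\<in>I. D i * x i) / S"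
    by (simp add: sum_divide_distrib)
  moreover have "\<dots> = 1" using S by (simp add: S_def)
  ultimately show ?thesis using D(2) by (intro bexI) auto
qed

text \<open>Truncation at zero agrees with the corner being nonnegative: the bound for \<open>max 0 (z
i)\<close> implies the one for \<open>z i\<close>, and the dual point vanishes wherever the truncation is
effective.\<close>
lemma orlicz_corner_support:
  fixes z :: "'i \<Rightarrow> real"
  assumes I: "finite I"
  defines "m \<equiv> Inf {l. l > 0 \<and> (\<Sum>i\<in>I. \<phi> (max 0 (z i) / l)) \<le> 1}"
  shows "\<And>a. a \<in> orlicz_corner \<phi> I \<Longrightarrow> (\<Sum>i\<in>I. a i * z i) \<le> m"
    and "\<exists>a\<in>orlicz_corner \<phi> I. (\<Sum>i\<in>I. a i * z i) = m"
proof -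
  have "(\<forall>a\<in>orlicz_corner \<phi> I. (\<Sum>i\<in>I. a i * z i) \<le> m) \<and> (\<exists>a\<in>orlicz_corner \<phi> I. (\<Sum>i\<in>I. a i * z i) = m)"
  proof (cases "\<exists>i\<in>I. 0 < z i")
    case False
    then have "{l. l > 0 \<and> (\<Sum>i\<in>I. \<phi> (max 0 (z i) / l)) \<le> 1} = {0<..}"
      by (auto simp: max_absorb1 not_less phi_zero[OF orl])
    then have m: "m = 0" by (simp add: m_def)
    have "(\<Sum>i\<in>I. a i * z i) \<le> 0" if "a \<in> orlicz_corner \<phi> I" for a
      using False orlicz_corner_D(1)[OF that] by (intro sum_nonpos mult_nonneg_nonpos) (auto simp: not_less)
    moreover have "(\<lambda>_. 0) \<in> orlicz_corner \<phi> I" using I by (intro small_in_orlicz_corner) auto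
    ultimately show ?thesis unfolding m by (auto intro!: bexI[of _ "\<lambda>_. 0"])
  next
    case True
    define z' where "z' = (\<lambda>i. max 0 (z i))"
    have z': "0 \<le> z' i" "z i \<le> z' i" for i by (auto simp: z'_def)
    obtain l where l: "l > 0" "(\<Sum>i\<in>I. \<phi> (z' i / l)) = 1"
    proof -
      from True obtain k where "k \<in> I" "0 < z' k" by (auto simp: z'_def)
      from orlicz_norm_attained[where z = z', OF I this z'(1)] that show ?thesis by blast
    qed
    have m: "m = l"
      unfolding m_def using orlicz_norm_eq_Inf[OF I z'(1) l] by (simp add: z'_def)
    have le: "(\<Sum>i\<in>I. a i * z i) \<le> l" if a: "a \<in> orlicz_corner \<phi> I" for a
    proof -
      have "(\<Sum>i\<in>I. a i * (z' i / l)) \<le> 1"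
        using l z' by (intro orlicz_corner_D(3)[OF a]) auto
      then have "(\<Sum>i\<in>I. a i * z' i) \<le> l" using l by (simp flip: sum_divide_distrib)
      moreover have "(\<Sum>i\<in>I. a i * z i) \<le> (\<Sum>i\<in>I. a i * z' i)"
        using z' orlicz_corner_D(1)[OF a] by (intro sum_mono mult_left_mono) auto
      ultimately show ?thesis by simp
    qed
    obtain a where a: "a \<in> orlicz_corner \<phi> I" "(\<Sum>i\<in>I. a i * (z' i / l)) = 1" "\<forall>i. z' i / l = 0 \<longrightarrow> a i = 0"
      using orlicz_corner_dual_point[OF I, of "\<lambda>i. z' i / l"] z' l by auto
    have "(\<Sum>i\<in>I. a i * z i) = (\<Sum>i\<in>I. a i * z' i)"
    proof (rule sum.cong)
      fix i show "a i * z i = a i * z' i" using a(3)[rule_format, of i] by (cases "0 \<le> z i") (auto simp: z'_def)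
    qed simp
    also have "\<dots> = l" using a(2) l by (simp add: field_simps flip: sum_divide_distrib)
    finally show ?thesis unfolding m using a(1) le by blast
  qed
  then show "\<And>a. a \<in> orlicz_corner \<phi> I \<Longrightarrow> (\<Sum>i\<in>I. a i * z i) \<le> m"
    and "\<exists>a\<in>orlicz_corner \<phi> I. (\<Sum>i\<in>I. a i * z i) = m" by blast+
qed

end

lemma support_function_determines:
  fixes K L :: "'a::euclidean_space set"
  assumes K: "K \<noteq> {}" "compact K" and L: "L \<noteq> {}" "compact L" "convex L"
    and le: "\<And>u. support_function K u \<le> support_function L u"
  shows "K \<subseteq> L"
proof
  fix x assume x: "x \<in> K"
  show "x \<in> L"
  proof (rule ccontr)
    assume "x \<notin> L"
    then obtain a b where ab: "a \<bullet> x < b" "\<And>y. y \<in> L \<Longrightarrow> b < a \<bullet> y"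
      using separating_hyperplane_closed_point[of L x] L compact_imp_closed by metis
    have "bdd_above ((\<lambda>y. y \<bullet> (-a)) ` K)"
      by (intro bounded_imp_bdd_above compact_imp_bounded compact_continuous_image K continuous_intros)
    then have "x \<bullet> (-a) \<le> support_function K (-a)"
      unfolding support_function_def using x by (rule cSUP_upper2[OF _ _ order_refl])
    also have "\<dots> \<le> support_function L (-a)" by (rule le)
    also have "\<dots> \<le> - b"
      unfolding support_function_def using ab(2) L(1) by (intro cSUP_least) (auto simp: inner_commute less_imp_le)
    finally show False using ab(1) by (simp add: inner_commute)
  qed
qed

lemma orlicz_zonotope_eq_comb:
  fixes \<Lambda> :: "'a::euclidean_space set"
  assumes orl: "\<phi> \<in> orlicz_class" and fin: "finite \<Lambda>"
  shows "orlicz_zonotope \<phi> \<Lambda> = comb \<Lambda> (\<lambda>w. w) ` orlicz_corner \<phi> \<Lambda>" (is "_ = ?Z")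
proof -
  interpret convex_corner \<Lambda> "orlicz_corner \<phi> \<Lambda>" by (rule convex_corner_orlicz[OF orl fin])
  have sup: "support_function ?Z u = orlicz_support \<phi> \<Lambda> u" for u
  proof -
    have i: "comb \<Lambda> (\<lambda>w. w) a \<bullet> u = (\<Sum>w\<in>\<Lambda>. a w * (w \<bullet> u))" for a
      by (simp add: comb_def inner_sum_left)
    note s = orlicz_corner_support[OF orl fin, where z = "\<lambda>w. w \<bullet> u", folded i inner_pos_def]
    show ?thesis unfolding support_function_def orlicz_support_def image_image
      using s by (intro cSup_eq_maximum) (auto intro: rev_image_eqI)
  qed
  have Z: "?Z \<noteq> {}" "compact ?Z" "convex ?Z" using compact_comb convex_comb zero by blast+
  show ?thesis unfolding orlicz_zonotope_def
  proof (rule the_equality)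
    show "?Z \<noteq> {} \<and> compact ?Z \<and> convex ?Z \<and> (\<forall>u. support_function ?Z u = orlicz_support \<phi> \<Lambda> u)"
      using Z sup by blast
    fix L assume L: "L \<noteq> {} \<and> compact L \<and> convex L \<and> (\<forall>u. support_function L u = orlicz_support \<phi> \<Lambda> u)"
    show "L = ?Z"
      by (rule antisym; rule support_function_determines) (use L Z sup in auto)
  qed
qed

section \<open>Families whose kernel is a sublattice\<close>

text \<open>This property of the linear dependencies of a family is the one that passes through the induction;
for finite spanning sets it characterises the invertible linear images of obtuse sets.\<close>
definition kernel_sublattice :: "'i set \<Rightarrow> ('i \<Rightarrow> 'a::real_vector) \<Rightarrow> bool" where
  "kernel_sublattice I W \<longleftrightarrow> (\<forall>m. comb I W m = 0 \<longrightarrow> comb I W (\<lambda>i. max 0 (m i)) = 0)"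

text \<open>The size of this set is the induction measure. Deleted vectors become zero but remain in the
family, and therefore zero vectors must not count as redundant.\<close>
definition redundant :: "'i set \<Rightarrow> ('i \<Rightarrow> 'a::real_vector) \<Rightarrow> 'i set" where
  "redundant I W = {i\<in>I. W i \<noteq> 0 \<and> W i \<in> span (W ` (I - {i}))}"

lemma comb_in_span: "comb I W a \<in> span (W ` I)"
  unfolding comb_def by (intro span_sum span_scale span_base) auto

lemma kernel_sublatticeD: "kernel_sublattice I W \<Longrightarrow> comb I W m = 0 \<Longrightarrow> comb I W (\<lambda>i. max 0 (m i)) = 0"
  by (simp add: kernel_sublattice_def)

lemma not_redundant_kernel:
  assumes I: "finite I" "redundant I W = {}" and m: "comb I W m = 0" "k \<in> I" "W k \<noteq> 0"
  shows "m k = 0"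
proof (rule ccontr)
  assume k: "m k \<noteq> 0"
  have "m k *\<^sub>R W k + comb (I - {k}) W m = 0"
    using m I by (simp add: comb_def sum.remove[of I k])
  then have "m k *\<^sub>R W k = - comb (I - {k}) W m" by (simp add: add_eq_0_iff2)
  moreover have "W k = inverse (m k) *\<^sub>R m k *\<^sub>R W k" using k by simp
  ultimately have "W k = (- inverse (m k)) *\<^sub>R comb (I - {k}) W m" by simp
  also have "\<dots> \<in> span (W ` (I - {k}))" by (intro span_scale comb_in_span)
  finally show False using I m by (auto simp: redundant_def)
qed

lemma kernel_sublattice_no_redundant:
  assumes "finite I" "redundant I W = {}"
  shows "kernel_sublattice I W"
  unfolding kernel_sublattice_def
proof (intro allI impI)
  fix m assume "comb I W m = 0"
  then have "m k = 0" if "k \<in> I" "W k \<noteq> 0" for k using not_redundant_kernel[OF assms] that by blast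
  then have "comb I W (\<lambda>i. max 0 (m i)) = comb I W (\<lambda>i. 0)" by (intro comb_cong) auto
  then show "comb I W (\<lambda>i. max 0 (m i)) = 0" by (simp add: comb_def)
qed

lemma redundant_delete:
  assumes "i \<in> redundant I W" shows "redundant I (W(i := 0)) \<subset> redundant I W"
proof -
  have "j \<in> redundant I W" if "j \<in> redundant I (W(i := 0))" for j
  proof -
    have j: "j \<in> I" "j \<noteq> i" "W j \<noteq> 0" "W j \<in> span ((W(i := 0)) ` (I - {j}))"
      using that by (auto simp: redundant_def split: if_splits)
    have "span ((W(i := 0)) ` (I - {j})) \<subseteq> span (insert 0 (W ` (I - {j})))" by (intro span_mono) auto
    then show ?thesis using j by (auto simp: redundant_def)
  qed
  moreover have "i \<notin> redundant I (W(i := 0))" by (auto simp: redundant_def)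
  ultimately show ?thesis using assms by blast
qed

lemma span_delete_redundant:
  assumes "i \<in> redundant I W" "span (W ` I) = UNIV"
  shows "span ((W(i := 0)) ` I) = UNIV"
proof -
  have "W j \<in> span ((W(i := 0)) ` I)" if "j \<in> I" for j
  proof (cases "j = i")
    case True
    have "W i \<in> span (W ` (I - {i}))" using assms by (simp add: redundant_def)
    also have "W ` (I - {i}) = (W(i := 0)) ` (I - {i})" by auto
    also have "span \<dots> \<subseteq> span ((W(i := 0)) ` I)" by (intro span_mono) auto
    finally show ?thesis using True by simp
  next
    case False
    then have "W j = (W(i := 0)) j" by simp
    then show ?thesis using that by (metis imageI span_base)
  qed
  then have "span (W ` I) \<subseteq> span ((W(i := 0)) ` I)" by (intro span_minimal) auto
  then show ?thesis using assms by auto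
qed

context
  fixes f :: "'a::real_vector \<Rightarrow> real" and W :: "'i \<Rightarrow> 'a" and i :: 'i and I :: "'i set"
  assumes lin: "linear f" and f1: "f (W i) = 1" and i: "i \<in> I" and fin: "finite I"
begin

lemma lin_simps: "f (x + y) = f x + f y" "f (x - y) = f x - f y" "f (c *\<^sub>R x) = c * f x" "f 0 = 0" "f (- x) = - f x"
  using lin by (simp_all add: linear_add linear_diff linear_cmul linear_0 linear_neg)

lemma isolate_self: "isolate f W i i = W i"
  by (simp add: isolate_def)

lemma redundant_isolate:
  assumes "i \<in> redundant I W" shows "redundant I (isolate f W i) \<subset> redundant I W"
proof -
  have "i \<notin> redundant I (isolate f W i)"
  proof
    assume "i \<in> redundant I (isolate f W i)"
    then have "W i \<in> span (isolate f W i ` (I - {i}))" by (simp add: redundant_def isolate_self)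
    moreover have "span (isolate f W i ` (I - {i})) \<subseteq> {x. f x = 0}"
      by (rule span_minimal) (auto simp: isolate_def lin_simps f1 subspace_def)
    ultimately show False using f1 by auto
  qed
  moreover have "j \<in> redundant I W" if *: "j \<in> redundant I (isolate f W i)" for j
  proof -
    have ji: "j \<noteq> i" using * calculation by auto
    have j: "j \<in> I" "W j - f (W j) *\<^sub>R W i \<noteq> 0" "W j - f (W j) *\<^sub>R W i \<in> span (isolate f W i ` (I - {j}))"
      using * ji by (auto simp: redundant_def isolate_def)
    have Wi: "W i \<in> span (W ` (I - {j}))" using ji i by (intro span_base) auto
    have "span (isolate f W i ` (I - {j})) \<subseteq> span (W ` (I - {j}))"
    proof (rule span_minimal)
      show "isolate f W i ` (I - {j}) \<subseteq> span (W ` (I - {j}))"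
      proof (rule image_subsetI)
        fix l assume l: "l \<in> I - {j}"
        then have "W l \<in> span (W ` (I - {j}))" by (intro span_base) auto
        then show "isolate f W i l \<in> span (W ` (I - {j}))"
          using Wi by (auto simp: isolate_def intro!: span_diff span_scale)
      qed
    qed simp
    then have "(W j - f (W j) *\<^sub>R W i) + f (W j) *\<^sub>R W i \<in> span (W ` (I - {j}))"
      using j Wi by (intro span_add span_scale) auto
    moreover have "W j \<noteq> 0" using j by (auto simp: lin_simps)
    ultimately show ?thesis using j by (simp add: redundant_def)
  qed
  ultimately show ?thesis using assms by blast
qed

lemma span_isolate:
  assumes "span (W ` I) = UNIV" shows "span (isolate f W i ` I) = UNIV"
proof -
  have Wi: "W i \<in> span (isolate f W i ` I)"
    by (metis i imageI isolate_self span_base)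
  have "W j \<in> span (isolate f W i ` I)" if "j \<in> I" for j
  proof (cases "j = i")
    case False
    have "isolate f W i j + f (W j) *\<^sub>R W i \<in> span (isolate f W i ` I)"
      by (intro span_add span_scale Wi span_base imageI that)
    then show ?thesis using False by (simp add: isolate_def)
  qed (use Wi in simp)
  then have "span (W ` I) \<subseteq> span (isolate f W i ` I)" by (intro span_minimal) auto
  then show ?thesis using assms by auto
qed

lemma comb_isolate_eq_0_iff:
  "comb I (isolate f W i) m = 0 \<longleftrightarrow> m i = 0 \<and> comb I (W(i := 0)) m = f (comb I (W(i := 0)) m) *\<^sub>R W i"
proof
  assume *: "comb I (isolate f W i) m = 0"
  then have "f (comb I (isolate f W i) m) = 0" by (simp add: lin_simps)
  then have "m i = 0" unfolding comb_isolate[OF fin i lin] by (simp add: lin_simps f1)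
  then show "m i = 0 \<and> comb I (W(i := 0)) m = f (comb I (W(i := 0)) m) *\<^sub>R W i"
    using * comb_isolate[OF fin i lin, of W m] by simp
next
  assume "m i = 0 \<and> comb I (W(i := 0)) m = f (comb I (W(i := 0)) m) *\<^sub>R W i"
  then show "comb I (isolate f W i) m = 0"
    using comb_isolate[OF fin i lin, of W m] by simp
qed

lemma kernel_sublattice_delete:
  assumes "kernel_sublattice I W" shows "kernel_sublattice I (W(i := 0))"
  unfolding kernel_sublattice_def
proof (intro allI impI)
  fix m assume "comb I (W(i := 0)) m = 0"
  moreover have "comb I W (m(i := 0)) = comb I (W(i := 0)) m"
    unfolding comb_def by (rule sum.cong) auto
  ultimately have "comb I W (\<lambda>j. max 0 ((m(i := 0)) j)) = 0" 
    using kernel_sublatticeD[OF assms, of "m(i := 0)"] by (simp del: fun_upd_apply)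
  moreover have "comb I W (\<lambda>j. max 0 ((m(i := 0)) j)) = comb I (W(i := 0)) (\<lambda>j. max 0 (m j))"
    unfolding comb_def by (rule sum.cong) auto
  ultimately show "comb I (W(i := 0)) (\<lambda>j. max 0 (m j)) = 0" by simp
qed

lemma kernel_sublattice_isolate:
  assumes "kernel_sublattice I W" shows "kernel_sublattice I (isolate f W i)"
  unfolding kernel_sublattice_def
proof (intro allI impI)
  fix m assume "comb I (isolate f W i) m = 0"
  then have m: "m i = 0" "comb I (W(i := 0)) m = f (comb I (W(i := 0)) m) *\<^sub>R W i"
    unfolding comb_isolate_eq_0_iff by auto
  define b where "b = f (comb I (W(i := 0)) m)"
  have c0: "comb I (W(i := 0)) (a(i := r)) = comb I (W(i := 0)) a" for a r by (rule comb_cong) auto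
  have "comb I W (m(i := - b)) = 0"
    unfolding comb_delete[OF fin i, of W] c0 using m by (simp add: b_def)
  then have "comb I W (\<lambda>j. max 0 ((m(i := - b)) j)) = 0" by (rule kernel_sublatticeD[OF assms])
  moreover have "(\<lambda>j. max 0 ((m(i := - b)) j)) = (\<lambda>j. max 0 (m j))(i := max 0 (- b))" by auto
  ultimately have "max 0 (- b) *\<^sub>R W i + comb I (W(i := 0)) (\<lambda>j. max 0 (m j)) = 0"
    by (simp add: comb_delete[OF fin i, of W] c0)
  then have *: "comb I (W(i := 0)) (\<lambda>j. max 0 (m j)) = (- max 0 (- b)) *\<^sub>R W i"
    using minus_unique by fastforce
  show "comb I (isolate f W i) (\<lambda>j. max 0 (m j)) = 0"
    unfolding comb_isolate_eq_0_iff * using m(1) by (simp add: lin_simps f1)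
qed

text \<open>Let \<open>m\<close> be a dependency whose positive part is none. As the isolated family has a
sublattice as its kernel, the positive and the negative part of \<open>m\<close> away from \<open>i\<close>
give multiples \<open>\<gamma>\<close> and \<open>\<gamma> + m i\<close> of \<open>W i\<close>. If one of
these numbers is positive, the claim follows. If both are at most zero, a suitable combination of the two
parts is a dependency of the deleted family, and its positive part is a multiple of the positive part of
\<open>m\<close>. This forces \<open>\<gamma> = 0\<close> or \<open>\<gamma> + m i = 0\<close>, and in either
case the positive part of \<open>m\<close> would be a dependency of \<open>W\<close>.\<close>
lemma nonneg_comb_of_lost_sublattice:
  assumes L0: "kernel_sublattice I (W(i := 0))" and L1: "kernel_sublattice I (isolate f W i)"
    and nL: "\<not> kernel_sublattice I W"
  shows "\<exists>p. (\<forall>j. 0 \<le> p j) \<and> comb I (W(i := 0)) p = W i"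
proof -
  let ?c = "comb I (W(i := 0))"
  have c0: "?c (a(i := r)) = ?c a" for a r by (rule comb_cong) auto
  obtain m where m: "comb I W m = 0" "comb I W (\<lambda>j. max 0 (m j)) \<noteq> 0"
    using nL by (auto simp: kernel_sublattice_def)
  define q where "q = (\<lambda>j. max 0 (m j))"
  define r where "r = (\<lambda>j. max 0 (- m j))"
  have cm: "?c m = (- m i) *\<^sub>R W i"
    using m(1) comb_delete[OF fin i, of W m] by (simp add: add_eq_0_iff2 add_eq_0_iff)
  have mqr: "m = (\<lambda>j. 1 * q j + (- 1) * r j)" by (auto simp: q_def r_def fun_eq_iff)
  have "comb I (isolate f W i) (m(i := 0)) = 0"
    unfolding comb_isolate_eq_0_iff c0 cm by (simp add: lin_simps f1)
  from kernel_sublatticeD[OF L1 this]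
  have "?c (\<lambda>j. max 0 ((m(i := 0)) j)) = f (?c (\<lambda>j. max 0 ((m(i := 0)) j))) *\<^sub>R W i"
    unfolding comb_isolate_eq_0_iff by simp
  moreover have "(\<lambda>j. max 0 ((m(i := 0)) j)) = q(i := 0)" by (auto simp: q_def)
  ultimately obtain \<gamma> where \<gamma>: "?c q = \<gamma> *\<^sub>R W i" using c0 by metis
  have "?c m = 1 *\<^sub>R ?c q + (- 1) *\<^sub>R ?c r" by (subst mqr) (rule comb_mix)
  then have \<delta>: "?c r = (\<gamma> + m i) *\<^sub>R W i"
    using cm \<gamma> by (simp add: algebra_simps)
  have pos: ?thesis if "?c p = g *\<^sub>R W i" "0 < g" "\<And>j. 0 \<le> p j" for p g
    using that comb_scale[of I "W(i := 0)" "inverse g" p]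
    by (intro exI[of _ "\<lambda>j. inverse g * p j"]) auto
  show ?thesis
  proof (rule ccontr)
    assume "\<not> ?thesis"
    then have neg: "\<gamma> \<le> 0" "\<gamma> + m i \<le> 0"
      using pos[OF \<gamma>] pos[OF \<delta>] by (fastforce simp: q_def r_def)+
    \<comment> \<open>The coefficients cancel the multiples of \<open>W i\<close>. They have the right signs for the first summand
      to be the positive part.\<close>
    define n where "n = (\<lambda>j. (- (\<gamma> + m i)) * q j + \<gamma> * r j)"
    have "?c n = 0" unfolding n_def comb_mix \<gamma> \<delta> by (simp add: algebra_simps)
    then have "?c (\<lambda>j. max 0 (n j)) = 0" by (rule kernel_sublatticeD[OF L0])
    moreover have "max 0 (n j) = (- (\<gamma> + m i)) * q j" for j
    proof (cases "0 \<le> m j")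
      case True
      then have "r j = 0" "0 \<le> q j" by (auto simp: q_def r_def)
      then show ?thesis using neg by (simp add: n_def mult_nonpos_nonneg)
    next
      case False
      then have "q j = 0" "0 \<le> r j" by (auto simp: q_def r_def)
      then show ?thesis using neg by (simp add: n_def mult_nonpos_nonneg)
    qed
    ultimately have "?c (\<lambda>j. (- (\<gamma> + m i)) * q j) = 0" by simp
    then have "((- (\<gamma> + m i)) * \<gamma>) *\<^sub>R W i = 0" unfolding comb_scale \<gamma> by simp
    moreover have "W i \<noteq> 0" using f1 lin_simps(4) by auto
    ultimately have "\<gamma> + m i = 0 \<or> \<gamma> = 0" by auto
    moreover have "comb I W q = (max 0 (m i) + \<gamma>) *\<^sub>R W i"
      unfolding comb_delete[OF fin i, of W q] \<gamma> by (simp add: q_def algebra_simps)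
    then have "max 0 (m i) + \<gamma> \<noteq> 0" using m(2) by (auto simp: q_def)
    ultimately show False using neg by auto
  qed
qed

end

section \<open>Volumes of the deleted and the isolated family\<close>

lemma emeasure_compact_eq_volume:
  fixes S :: "'a::euclidean_space set"
  assumes "compact S" shows "emeasure lborel S = ennreal (measure lebesgue S)"
proof -
  have "S \<in> sets lborel" using assms by (simp add: borel_compact)
  moreover have "emeasure lborel S \<noteq> \<infinity>" using emeasure_compact_finite[OF assms] by simp
  ultimately show ?thesis by (simp add: emeasure_eq_ennreal_measure measure_completion)
qed

lemma (in convex_corner) comb_positive_volume:
  fixes W :: "'i \<Rightarrow> 'a::euclidean_space"
  assumes "span (W ` I) = UNIV" shows "0 < measure lebesgue (comb I W ` K)"
  using comb_positive_measure[OF assms] unfolding emeasure_compact_eq_volume[OF compact_comb] by simp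

context corner_step
begin

lemma volume_step_le:
  "measure lebesgue (comb I W ` K) \<le> measure lebesgue (comb I W1 ` K) + measure lebesgue (comb I W0 ` K)"
  using step_le unfolding emeasure_compact_eq_volume[OF compact_comb] by (simp flip: ennreal_plus)

lemma volume_step_less:
  assumes span: "span (W ` I) = UNIV"
    and pos: "c \<in> K" "comb I W0 c = t *\<^sub>R W i" "t > 0"
    and face: "\<And>a. a \<in> K \<Longrightarrow> a i = 1 \<Longrightarrow> \<exists>r>1. (\<lambda>j. r * (a(i := 0)) j) \<in> K"
  shows "measure lebesgue (comb I W ` K) < measure lebesgue (comb I W1 ` K) + measure lebesgue (comb I W0 ` K)"
proof -
  have "emeasure lborel (comb I W ` K) < emeasure lborel (comb I W1 ` K) + emeasure lborel (comb I W0 ` K)"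
    by (rule step_less[OF span pos]) (rule face)
  then show ?thesis
    unfolding emeasure_compact_eq_volume[OF compact_comb] by (simp add: ennreal_less_iff flip: ennreal_plus)
qed

lemma volume_step_eq:
  assumes "\<And>a b. a \<in> K \<Longrightarrow> b \<in> K \<Longrightarrow> shadow (comb I W0 a) = shadow (comb I W0 b) \<Longrightarrow>
     \<exists>c\<in>K. shadow (comb I W0 c) = shadow (comb I W0 a) \<and> a i + f (comb I W0 b) \<le> c i + f (comb I W0 c)"
  shows "measure lebesgue (comb I W ` K) = measure lebesgue (comb I W1 ` K) + measure lebesgue (comb I W0 ` K)"
proof -
  have "emeasure lborel (comb I W ` K) = emeasure lborel (comb I W1 ` K) + emeasure lborel (comb I W0 ` K)"
    by (rule step_eq) (rule assms)
  then show ?thesis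
    unfolding emeasure_compact_eq_volume[OF compact_comb] by (simp flip: ennreal_plus)
qed

lemma volume_step_eq_decoupled:
  assumes free: "\<And>a b. a \<in> K \<Longrightarrow> b \<in> K \<Longrightarrow> b(i := a i) \<in> K"
  shows "measure lebesgue (comb I W ` K) = measure lebesgue (comb I W1 ` K) + measure lebesgue (comb I W0 ` K)"
proof (rule volume_step_eq)
  fix a b assume *: "a \<in> K" "b \<in> K" "shadow (comb I W0 a) = shadow (comb I W0 b)"
  have "comb I W0 (b(i := a i)) = comb I W0 b" by (rule comb_cong) auto
  then show "\<exists>c\<in>K. shadow (comb I W0 c) = shadow (comb I W0 a) \<and> a i + f (comb I W0 b) \<le> c i + f (comb I W0 c)"
    using * free[OF *(1,2)] by (intro bexI[of _ "b(i := a i)"]) simp_all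
qed

text \<open>Let \<open>a\<close> maximise the coordinate at \<open>i\<close> and let \<open>b\<close> maximise
the height of the other vectors. If \<open>b\<close> is higher by \<open>d > 0\<close>, then \<open>a -
b\<close>, with the entry \<open>d\<close> at \<open>i\<close>, is a dependency. Its positive part is a
dependency too, and subtracting it from \<open>a\<close> away from \<open>i\<close> gives the minimum of
\<open>a\<close> and \<open>b\<close>. Hence this minimum reaches the height of \<open>b\<close>. It lies
below \<open>a\<close>, so the entry \<open>a i\<close> can be kept within the corner.\<close>
lemma volume_step_eq_sublattice:
  assumes L: "kernel_sublattice I W"
  shows "measure lebesgue (comb I W ` K) = measure lebesgue (comb I W1 ` K) + measure lebesgue (comb I W0 ` K)"
proof (rule volume_step_eq)
  fix a b assume *: "a \<in> K" "b \<in> K" "shadow (comb I W0 a) = shadow (comb I W0 b)"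
  show "\<exists>c\<in>K. shadow (comb I W0 c) = shadow (comb I W0 a) \<and> a i + f (comb I W0 b) \<le> c i + f (comb I W0 c)"
  proof (cases "f (comb I W0 b) \<le> f (comb I W0 a)")
    case True
    then show ?thesis using * by (intro bexI[of _ a]) auto
  next
    case False
    define d where "d = f (comb I W0 b) - f (comb I W0 a)"
    have d: "d > 0" using False by (simp add: d_def)
    have c0: "comb I W0 (a(i := r)) = comb I W0 a" for a r by (rule comb_cong) auto
    define m where "m = (\<lambda>j. 1 * a j + (- 1) * b j)"
    have m0: "comb I W0 m = - d *\<^sub>R W i"
      unfolding m_def comb_mix using *(3) by (simp add: shadow_def d_def algebra_simps)
    have "comb I W (m(i := d)) = 0"
      unfolding comb_delete[OF finite_I i, of W] c0 m0 by simp
    then have "comb I W (\<lambda>j. max 0 ((m(i := d)) j)) = 0" by (rule kernel_sublatticeD[OF L])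
    moreover have "(\<lambda>j. max 0 ((m(i := d)) j)) = (\<lambda>j. max 0 (m j))(i := d)" using d by auto
    ultimately have "d *\<^sub>R W i + comb I W0 (\<lambda>j. max 0 (m j)) = 0"
      using d by (simp add: comb_delete[OF finite_I i, of W] c0)
    then have p: "comb I W0 (\<lambda>j. max 0 (m j)) = - (d *\<^sub>R W i)" by (metis minus_unique)
    define c where "c = (\<lambda>j. min (a j) (b j))(i := a i)"
    have "comb I W0 c = comb I W0 (\<lambda>j. 1 * a j + (- 1) * max 0 (m j))"
      unfolding c_def c0 by (rule comb_cong) (auto simp: m_def)
    also have "\<dots> = comb I W0 a + d *\<^sub>R W i" unfolding comb_mix p by simp
    finally have c: "comb I W0 c = comb I W0 a + d *\<^sub>R W i" .
    have "c \<in> K" by (rule down[OF *(1)]) (auto simp: c_def nonneg[OF *(1)] nonneg[OF *(2)])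
    moreover have "shadow (comb I W0 c) = shadow (comb I W0 a)"
      unfolding c by (simp add: shadow_def f_simps f_Wi algebra_simps)
    moreover have "f (comb I W0 c) = f (comb I W0 b)" unfolding c by (simp add: f_simps f_Wi d_def)
    moreover have "c i = a i" by (simp add: c_def)
    ultimately show ?thesis by (intro bexI[of _ c]) simp_all
  qed
qed

end

lemma unit_cube_decoupled:
  assumes "finite I" "i \<in> I" "a \<in> orlicz_corner (\<lambda>t. t) I" "b \<in> orlicz_corner (\<lambda>t. t) I"
  shows "b(i := a i) \<in> orlicz_corner (\<lambda>t. t) I"
proof (rule orlicz_corner_I)
  fix x assume x: "\<And>i. i \<in> I \<Longrightarrow> 0 \<le> x i" "(\<Sum>i\<in>I. x i) \<le> (1::real)"
  have "(b(i := a i)) j \<le> 1" for j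
    using orlicz_corner_le_one[OF identity_orlicz assms(1)] assms by auto
  then have "(\<Sum>j\<in>I. (b(i := a i)) j * x j) \<le> (\<Sum>j\<in>I. x j)"
    using x by (intro sum_mono) (auto simp: mult_left_le_one_le orlicz_corner_D(1)[OF assms(3)] orlicz_corner_D(1)[OF assms(4)])
  then show "(\<Sum>j\<in>I. (b(i := a i)) j * x j) \<le> 1" using x by simp
qed (use assms orlicz_corner_D[OF assms(3)] orlicz_corner_D[OF assms(4)] in auto)

section \<open>Independent families\<close>

lemma lborel_distr_reflect:
  fixes c :: "'a::euclidean_space"
  shows "distr lborel borel (\<lambda>x. c - x) = lborel"
  using lborel_affine[of "-1" c] by (simp add: density_1)

text \<open>The uniqueness argument for invariant measures. The double integral of \<open>1\<^sub>A (h y) *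
1\<^sub>B (h y + x)\<close> is evaluated in both orders of integration: the inner integral over
\<open>x\<close> gives the volume of \<open>B\<close>; after the translation of \<open>y\<close> by \<open>- g
x\<close> it gives the volume of \<open>A\<close>. Only the proportionality of the volumes matters for a
ratio, so the determinant never has to appear.\<close>
lemma emeasure_linear_image_proportional:
  fixes g h :: "'a::euclidean_space \<Rightarrow> 'a"
  assumes g: "linear g" and h: "linear h" and gh: "\<And>x. g (h x) = x" and hg: "\<And>x. h (g x) = x"
    and A[measurable]: "A \<in> sets borel" and B[measurable]: "B \<in> sets borel"
  shows "emeasure lborel (g ` A) * emeasure lborel B = emeasure lborel (g ` B) * emeasure lborel A"
proof -
  have [measurable]: "h \<in> borel_measurable borel"
    by (intro borel_measurable_continuous_onI linear_continuous_on linear_conv_bounded_linear[THEN iffD1] h)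
  have img: "g ` S = h -` S" for S 
    by (auto simp: hg intro!: image_eqI[of _ g "h _"] gh[symmetric])
  have vol: "emeasure lborel (g ` S) = (\<integral>\<^sup>+y. indicator S (h y) \<partial>lborel)" if [measurable]: "S \<in> sets borel" for S
  proof -
    have "h -` S \<inter> space borel \<in> sets borel" by measurable
    then have "emeasure lborel (h -` S) = (\<integral>\<^sup>+y. indicator (h -` S) y \<partial>lborel)" by simp
    then show ?thesis unfolding img by (simp add: indicator_vimage[unfolded comp_def])
  qed
  have "(\<integral>\<^sup>+y. (\<integral>\<^sup>+x. indicator A (h y) * indicator B (h y + x) \<partial>lborel) \<partial>lborel)
      = (\<integral>\<^sup>+y. indicator A (h y) * emeasure lborel B \<partial>lborel)"
  proof (rule nn_integral_cong)
    fix y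
    have "(\<integral>\<^sup>+x. indicator B (h y + x) \<partial>lborel) = (\<integral>\<^sup>+x. indicator B x \<partial>distr lborel borel ((+) (h y)))"
      by (subst nn_integral_distr) auto
    then show "(\<integral>\<^sup>+x. indicator A (h y) * indicator B (h y + x) \<partial>lborel) = indicator A (h y) * emeasure lborel B"
      by (simp add: nn_integral_cmult lborel_distr_plus)
  qed
  also have "\<dots> = emeasure lborel (g ` A) * emeasure lborel B"
    by (simp add: nn_integral_multc vol)
  finally have 1: "emeasure lborel (g ` A) * emeasure lborel B =
      (\<integral>\<^sup>+y. (\<integral>\<^sup>+x. indicator A (h y) * indicator B (h y + x) \<partial>lborel) \<partial>lborel)" by simp
  also have "\<dots> = (\<integral>\<^sup>+x. (\<integral>\<^sup>+y. indicator A (h y) * indicator B (h y + x) \<partial>lborel) \<partial>lborel)"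
    by (rule lborel_pair.Fubini') measurable
  also have "\<dots> = (\<integral>\<^sup>+x. (\<integral>\<^sup>+y. indicator A (h y - x) * indicator B (h y) \<partial>lborel) \<partial>lborel)"
  proof (rule nn_integral_cong)
    fix x
    have "(\<integral>\<^sup>+y. indicator A (h y - x) * indicator B (h y) \<partial>lborel)
      = (\<integral>\<^sup>+y. indicator A (h y - x) * indicator B (h y) \<partial>distr lborel borel ((+) (g x)))"
      by (simp add: lborel_distr_plus)
    also have "\<dots> = (\<integral>\<^sup>+y. indicator A (h (g x + y) - x) * indicator B (h (g x + y)) \<partial>lborel)"
      by (subst nn_integral_distr) auto
    also have "\<dots> = (\<integral>\<^sup>+y. indicator A (h y) * indicator B (h y + x) \<partial>lborel)"
      by (simp add: linear_add[OF h] hg add.commute)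
    finally show "(\<integral>\<^sup>+y. indicator A (h y) * indicator B (h y + x) \<partial>lborel)
      = (\<integral>\<^sup>+y. indicator A (h y - x) * indicator B (h y) \<partial>lborel)" by simp
  qed
  also have "\<dots> = (\<integral>\<^sup>+y. (\<integral>\<^sup>+x. indicator A (h y - x) * indicator B (h y) \<partial>lborel) \<partial>lborel)"
    by (rule lborel_pair.Fubini') measurable
  also have "\<dots> = (\<integral>\<^sup>+y. emeasure lborel A * indicator B (h y) \<partial>lborel)"
  proof (rule nn_integral_cong)
    fix y
    have "(\<integral>\<^sup>+x. indicator A (h y - x) \<partial>lborel) = (\<integral>\<^sup>+x. indicator A x \<partial>distr lborel borel (\<lambda>x. h y - x))"
      by (subst nn_integral_distr) auto
    then show "(\<integral>\<^sup>+x. indicator A (h y - x) * indicator B (h y) \<partial>lborel) = emeasure lborel A * indicator B (h y)"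
      by (simp add: nn_integral_multc lborel_distr_reflect)
  qed
  also have "\<dots> = emeasure lborel (g ` B) * emeasure lborel A"
    by (simp add: nn_integral_cmult vol mult.commute)
  finally show ?thesis .
qed

lemma comb_orlicz_linear_image:
  fixes W :: "'i \<Rightarrow> real ^ 'n"
  assumes orl: "\<phi> \<in> orlicz_class" and I: "finite I" and \<sigma>: "inj_on \<sigma> Basis" "\<sigma> ` Basis \<subseteq> I"
    and zero: "\<And>i. i \<in> I - \<sigma> ` Basis \<Longrightarrow> W i = 0"
  shows "comb I W ` orlicz_corner \<phi> I =
    (\<lambda>x. \<Sum>b\<in>Basis. (x \<bullet> b) *\<^sub>R W (\<sigma> b)) ` orlicz_zonotope \<phi> (Basis :: (real ^ 'n) set)"
proof -
  let ?M = "\<lambda>x. \<Sum>b\<in>Basis. (x \<bullet> b) *\<^sub>R W (\<sigma> b)"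
  let ?B = "Basis :: (real ^ 'n) set"
  have M: "?M (comb ?B (\<lambda>w. w) a) = (\<Sum>b\<in>?B. a b *\<^sub>R W (\<sigma> b))" for a
    by (rule sum.cong) (simp_all add: comb_def)
  have C: "comb I W a = (\<Sum>b\<in>?B. a (\<sigma> b) *\<^sub>R W (\<sigma> b))" for a
    unfolding comb_def by (rule sum_over_injection[OF I \<sigma>]) (use zero in auto)
  show ?thesis unfolding orlicz_zonotope_eq_comb[OF orl finite_Basis] image_image M
  proof (intro equalityI image_subsetI)
    fix a assume "a \<in> orlicz_corner \<phi> I"
    from orlicz_corner_pullback[OF orl I \<sigma> this]
    show "comb I W a \<in> (\<lambda>a. \<Sum>b\<in>?B. a b *\<^sub>R W (\<sigma> b)) ` orlicz_corner \<phi> ?B"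
      by (rule rev_image_eqI) (simp add: C)
  next
    fix a assume "a \<in> orlicz_corner \<phi> ?B"
    from orlicz_corner_pushforward[OF orl I \<sigma> this]
    show "(\<Sum>b\<in>?B. a b *\<^sub>R W (\<sigma> b)) \<in> comb I W ` orlicz_corner \<phi> I"
      by (rule rev_image_eqI) (simp add: C \<sigma>)
  qed
qed

lemma no_redundant_enumeration:
  fixes W :: "'i \<Rightarrow> 'a::euclidean_space"
  assumes I: "finite I" and R: "redundant I W = {}" and span: "span (W ` I) = UNIV"
  obtains \<sigma> :: "'a \<Rightarrow> 'i" where "inj_on \<sigma> Basis" "\<sigma> ` Basis = {i\<in>I. W i \<noteq> 0}"
proof -
  let ?S = "{i\<in>I. W i \<noteq> 0}"
  have ind: "W i \<notin> span (W ` (I - {i}))" if "i \<in> ?S" for i using R that by (auto simp: redundant_def)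
  have inj: "inj_on W ?S"
  proof (rule inj_onI, rule ccontr)
    fix i j assume ij: "i \<in> ?S" "j \<in> ?S" "W i = W j" "i \<noteq> j"
    then have "W i \<in> span (W ` (I - {i}))" by (intro span_base) auto
    then show False using ind ij by blast
  qed
  have "independent (W ` ?S)"
    unfolding dependent_def
  proof safe
    fix i assume i: "i \<in> I" "W i \<noteq> 0" "W i \<in> span (W ` ?S - {W i})"
    have "span (W ` ?S - {W i}) \<subseteq> span (W ` (I - {i}))" by (intro span_mono) auto
    then show False using ind i by auto
  qed
  moreover have "span (W ` ?S) = UNIV"
  proof -
    have "W ` I \<subseteq> insert 0 (W ` ?S)" by auto
    then have "span (W ` I) \<subseteq> span (insert 0 (W ` ?S))" by (rule span_mono)
    then show ?thesis using span by auto
  qed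
  ultimately have "card (W ` ?S) = DIM('a)"
    using dim_eq_card[of "W ` ?S" UNIV] by simp
  then have "card (Basis :: 'a set) = card ?S" using inj by (simp add: card_image)
  then obtain \<sigma> where "bij_betw \<sigma> (Basis :: 'a set) ?S"
    using I finite_same_card_bij[of "Basis :: 'a set" ?S] by auto
  then show ?thesis using that[of \<sigma>] by (simp add: bij_betw_def)
qed

lemma volume_linear_image_proportional:
  fixes g :: "'a::euclidean_space \<Rightarrow> 'a"
  assumes g: "linear g" "surj g" and A: "compact A" and B: "compact B"
  shows "measure lebesgue (g ` A) * measure lebesgue B = measure lebesgue (g ` B) * measure lebesgue A"
proof -
  obtain h where h: "linear h" "\<forall>x. h (g x) = x" "\<forall>x. g (h x) = x"
    using linear_surjective_isomorphism[OF g] by blast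
  have c: "compact (g ` S)" if "compact S" for S
    using that g(1) by (intro compact_continuous_image linear_continuous_on linear_conv_bounded_linear[THEN iffD1])
  have "emeasure lborel (g ` A) * emeasure lborel B = emeasure lborel (g ` B) * emeasure lborel A"
    using h A B g by (intro emeasure_linear_image_proportional[of g h] borel_compact) auto
  then show ?thesis
    using A B c by (simp add: emeasure_compact_eq_volume flip: ennreal_mult)
qed

lemma compact_orlicz_zonotope:
  fixes \<Lambda> :: "'a::euclidean_space set"
  assumes "\<phi> \<in> orlicz_class" "finite \<Lambda>" shows "compact (orlicz_zonotope \<phi> \<Lambda>)"
proof -
  interpret convex_corner \<Lambda> "orlicz_corner \<phi> \<Lambda>" by (rule convex_corner_orlicz[OF assms])
  show ?thesis unfolding orlicz_zonotope_eq_comb[OF assms] by (rule compact_comb)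
qed

lemma sum_inner_Basis:
  fixes F :: "'a::euclidean_space \<Rightarrow> 'b::real_vector"
  assumes "b \<in> Basis" shows "(\<Sum>b'\<in>Basis. (b \<bullet> b') *\<^sub>R F b') = F b"
proof -
  have "(\<Sum>b'\<in>Basis. (b \<bullet> b') *\<^sub>R F b') = (\<Sum>b'\<in>Basis. if b' = b then F b else 0)"
    using assms by (intro sum.cong) (auto simp: inner_Basis)
  then show ?thesis using assms by simp
qed

lemma comb_volume_comparison_no_redundant:
  fixes W :: "'i \<Rightarrow> real ^ 'n"
  assumes orl: "\<phi> \<in> orlicz_class" and I: "finite I" and R: "redundant I W = {}"
  shows "measure lebesgue (comb I W ` orlicz_corner \<phi> I) =
    volume_ratio \<phi> (Basis :: (real ^ 'n) set) * measure lebesgue (comb I W ` orlicz_corner (\<lambda>t. t) I)"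
proof (cases "span (W ` I) = UNIV")
  case True
  then obtain \<sigma> where \<sigma>: "inj_on \<sigma> (Basis :: (real ^ 'n) set)" "\<sigma> ` Basis = {i\<in>I. W i \<noteq> 0}"
    using no_redundant_enumeration[OF I R] by metis
  define M where "M = (\<lambda>x :: real ^ 'n. \<Sum>b\<in>Basis. (x \<bullet> b) *\<^sub>R W (\<sigma> b))"
  let ?B = "Basis :: (real ^ 'n) set"
  have lin: "linear M" unfolding M_def by (intro linearI) (simp_all add: inner_add_left scaleR_left_distrib sum.distrib scaleR_sum_right)
  have image: "comb I W ` orlicz_corner \<psi> I = M ` orlicz_zonotope \<psi> ?B" if "\<psi> \<in> orlicz_class" for \<psi>
    unfolding M_def by (rule comb_orlicz_linear_image[OF that I \<sigma>(1)]) (use \<sigma>(2) in auto)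
  have "surj M"
  proof -
    have "W i \<in> range M" if "i \<in> I" for i
    proof (cases "W i = 0")
      case True
      then show ?thesis using linear_0[OF lin] by (metis rangeI)
    next
      case False
      then have "i \<in> \<sigma> ` ?B" using \<sigma>(2) that by simp
      then obtain b where b: "b \<in> ?B" "i = \<sigma> b" by blast
      have "M b = W i" unfolding M_def b(2) by (rule sum_inner_Basis[OF b(1)])
      then show ?thesis by (metis rangeI)
    qed
    then have "span (W ` I) \<subseteq> range M"
      by (intro span_minimal linear_subspace_image lin subspace_UNIV) auto
    then show ?thesis using True by auto
  qed
  then have vols: "measure lebesgue (M ` orlicz_zonotope \<phi> ?B) * measure lebesgue (orlicz_zonotope (\<lambda>t. t) ?B) =
      measure lebesgue (M ` orlicz_zonotope (\<lambda>t. t) ?B) * measure lebesgue (orlicz_zonotope \<phi> ?B)"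
    using compact_orlicz_zonotope[OF orl finite_Basis] compact_orlicz_zonotope[OF identity_orlicz finite_Basis]
    by (intro volume_linear_image_proportional[OF lin])
  interpret convex_corner ?B "orlicz_corner (\<lambda>t. t) ?B" by (rule convex_corner_orlicz[OF identity_orlicz finite_Basis])
  have "0 < measure lebesgue (orlicz_zonotope (\<lambda>t. t) ?B)"
    unfolding orlicz_zonotope_eq_comb[OF identity_orlicz finite_Basis] by (intro comb_positive_volume) simp
  then show ?thesis
    using vols unfolding image[OF orl] image[OF identity_orlicz] volume_ratio_def by (simp add: field_simps)
next
  case False
  have "negligible (comb I W ` K)" for K
  proof (rule negligible_subset[OF negligible_lowdim])
    show "dim (span (W ` I)) < DIM(real ^ 'n)" 
      using False dim_eq_full[of "W ` I"] dim_subset_UNIV[of "W ` I"] by simp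
    show "comb I W ` K \<subseteq> span (W ` I)" using comb_in_span by auto
  qed
  then show ?thesis by (simp add: negligible_imp_measure0)
qed

section \<open>Comparison with the unit cube\<close>

text \<open>Induction on the number of redundant vectors. A loss of the sublattice property is inherited by
one of the two smaller families or else makes the present step strict; in both cases strictness survives the
addition, because the other inequalities are at least weak.\<close>
theorem comb_volume_comparison:
  fixes W :: "'i \<Rightarrow> real ^ 'n"
  assumes orl: "\<phi> \<in> orlicz_class" and I: "finite I"
  defines "V \<equiv> \<lambda>W. measure lebesgue (comb I W ` orlicz_corner \<phi> I)"
    and "U \<equiv> \<lambda>W. measure lebesgue (comb I W ` orlicz_corner (\<lambda>t. t) I)"
    and "c \<equiv> volume_ratio \<phi> (Basis :: (real ^ 'n) set)"
  shows "V W \<le> c * U W \<and> (kernel_sublattice I W \<longrightarrow> V W = c * U W) \<and>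
    (span (W ` I) = UNIV \<and> \<not> kernel_sublattice I W \<and> \<phi> (1 / 2) < 1 / 2 \<longrightarrow> V W < c * U W)"
proof (induction "redundant I W" arbitrary: W rule: measure_induct_rule[of card])
  case (less W)
  show ?case
  proof (cases "redundant I W = {}")
    case True
    then show ?thesis
      using comb_volume_comparison_no_redundant[OF orl I True] kernel_sublattice_no_redundant[OF I True]
      by (simp add: V_def U_def c_def)
  next
    case False
    then obtain i where iR: "i \<in> redundant I W" by blast
    then have i: "i \<in> I" "W i \<noteq> 0" by (auto simp: redundant_def)
    define f where "f = (\<lambda>x. (x \<bullet> W i) / (W i \<bullet> W i))"
    have lin: "linear f" unfolding f_def by (intro linearI) (simp_all add: inner_add_left add_divide_distrib)
    have f1: "f (W i) = 1" using i by (simp add: f_def)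
    interpret P: corner_step I "orlicz_corner \<phi> I" W i f
      using convex_corner_orlicz[OF orl I] i lin f1 by (simp add: corner_step_def corner_step_axioms_def)
    interpret C: corner_step I "orlicz_corner (\<lambda>t. t) I" W i f
      using convex_corner_orlicz[OF identity_orlicz I] i lin f1 by (simp add: corner_step_def corner_step_axioms_def)
    have U: "U W = U P.W1 + U P.W0"
      unfolding U_def by (rule C.volume_step_eq_decoupled) (rule unit_cube_decoupled[OF I i(1)])
    have V: "V W \<le> V P.W1 + V P.W0" unfolding V_def by (rule P.volume_step_le)
    have finR: "finite (redundant I W)" using I by (simp add: redundant_def)
    have IH0: "V P.W0 \<le> c * U P.W0 \<and> (kernel_sublattice I P.W0 \<longrightarrow> V P.W0 = c * U P.W0) \<and>
      (span (P.W0 ` I) = UNIV \<and> \<not> kernel_sublattice I P.W0 \<and> \<phi> (1 / 2) < 1 / 2 \<longrightarrow> V P.W0 < c * U P.W0)"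
      by (rule less.hyps) (intro psubset_card_mono finR redundant_delete iR)
    have IH1: "V P.W1 \<le> c * U P.W1 \<and> (kernel_sublattice I P.W1 \<longrightarrow> V P.W1 = c * U P.W1) \<and>
      (span (P.W1 ` I) = UNIV \<and> \<not> kernel_sublattice I P.W1 \<and> \<phi> (1 / 2) < 1 / 2 \<longrightarrow> V P.W1 < c * U P.W1)"
      by (rule less.hyps) (intro psubset_card_mono finR redundant_isolate[where f = f and W = W and i = i and I = I, OF lin f1 i(1) I] iR)
    have le: "V W \<le> c * U W" using U V IH0 IH1 by (simp add: distrib_left)
    have eq: "V W = c * U W" if L: "kernel_sublattice I W"
    proof -
      have "V W = V P.W1 + V P.W0" unfolding V_def by (rule P.volume_step_eq_sublattice[OF L])
      moreover have "kernel_sublattice I P.W0" "kernel_sublattice I P.W1"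
        using kernel_sublattice_delete[where f = f and W = W and i = i and I = I, OF lin f1 i(1) I L] kernel_sublattice_isolate[where f = f and W = W and i = i and I = I, OF lin f1 i(1) I L] by auto
      ultimately show ?thesis using U IH0 IH1 by (simp add: distrib_left)
    qed
    have lt: "V W < c * U W" if span: "span (W ` I) = UNIV" and nL: "\<not> kernel_sublattice I W" and half: "\<phi> (1 / 2) < 1 / 2"
    proof (cases "kernel_sublattice I P.W0 \<and> kernel_sublattice I P.W1")
      case False
      then have "V P.W0 < c * U P.W0 \<or> V P.W1 < c * U P.W1"
        using IH0 IH1 half span_delete_redundant[OF iR span] span_isolate[where f = f and W = W and i = i and I = I, OF lin f1 i(1) I span] by blast
      then show ?thesis using U V IH0 IH1 by (auto simp: distrib_left)
    next
      case True
      then obtain p where p: "\<And>j. 0 \<le> p j" "comb I P.W0 p = W i"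
        using nonneg_comb_of_lost_sublattice[where f = f and W = W and i = i and I = I, OF lin f1 i(1) I _ _ nL] by blast
      \<comment> \<open>Scaling makes the coefficients small enough for the corner; adding 1 avoids division by zero.\<close>
      define s where "s = 1 + sum p I"
      have s: "s \<ge> 1" "sum p I \<le> s" using p sum_nonneg[of I p] by (auto simp: s_def)
      define q where "q = (\<lambda>j. if j \<in> I then inverse s * p j else 0)"
      have "q \<in> orlicz_corner \<phi> I"
      proof (rule small_in_orlicz_corner[OF orl I])
        have "sum q I = inverse s * sum p I" by (simp add: q_def sum_distrib_left)
        also have "\<dots> \<le> inverse s * s" using s by (intro mult_left_mono) auto
        finally show "sum q I \<le> 1" using s by simp
      qed (use p s in \<open>auto simp: q_def\<close>)
      moreover have "comb I P.W0 q = inverse s *\<^sub>R W i"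
      proof -
        have "comb I P.W0 q = comb I P.W0 (\<lambda>j. inverse s * p j)" by (rule comb_cong) (simp add: q_def)
        then show ?thesis using p by (simp add: comb_scale)
      qed
      ultimately have "V W < V P.W1 + V P.W0"
        unfolding V_def
        by (rule P.volume_step_less[OF span]) (use s orlicz_corner_face[OF orl I half i(1)] in auto)
      then show ?thesis using U IH0 IH1 by (simp add: distrib_left)
    qed
    show ?thesis using le eq lt by blast
  qed
qed

section \<open>Obtuse sets\<close>

lemma kernel_sublattice_obtuse:
  fixes A :: "'a::real_inner set"
  assumes fin: "finite A" and obt: "obtuse A"
  shows "kernel_sublattice A (\<lambda>w. w)"
  unfolding kernel_sublattice_def
proof (intro allI impI)
  fix m assume m: "comb A (\<lambda>w. w) m = 0"
  define z where "z = comb A (\<lambda>w. w) (\<lambda>w. max 0 (m w))"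
  have "comb A (\<lambda>w. w) m = z - comb A (\<lambda>w. w) (\<lambda>w. max 0 (- m w))"
    unfolding z_def comb_def sum_subtractf[symmetric] by (rule sum.cong) (auto simp: max_def)
  with m have z: "z = comb A (\<lambda>w. w) (\<lambda>w. max 0 (- m w))" by simp
  have "z \<bullet> z = (\<Sum>u\<in>A. \<Sum>v\<in>A. (max 0 (m u) * max 0 (- m v)) * (u \<bullet> v))"
    by (subst (2) z, subst z_def, unfold comb_def inner_sum_left)
      (simp add: inner_sum_right sum_distrib_left mult_ac)
  also have "\<dots> \<le> 0"
  proof (intro sum_nonpos)
    fix u v assume uv: "u \<in> A" "v \<in> A"
    show "(max 0 (m u) * max 0 (- m v)) * (u \<bullet> v) \<le> 0"
    proof (cases "u = v")
      case False
      then have "inner_pos u v = 0" using uv obt by (auto simp: obtuse_def)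
      then have "u \<bullet> v \<le> 0" by (simp add: inner_pos_def max_def split: if_splits)
      then show ?thesis by (intro mult_nonneg_nonpos) auto
    qed (auto simp: max_def)
  qed
  finally show "comb A (\<lambda>w. w) (\<lambda>w. max 0 (m w)) = 0"
    unfolding z_def[symmetric] using inner_ge_zero[of z] by (metis inner_eq_zero_iff order_antisym)
qed

lemma kernel_sublattice_injective_image:
  fixes g :: "'a::real_vector \<Rightarrow> 'b::real_vector"
  assumes lin: "linear g" and inj: "inj g" and L: "kernel_sublattice A (\<lambda>w. w)"
  shows "kernel_sublattice (g ` A) (\<lambda>w. w)"
  unfolding kernel_sublattice_def
proof (intro allI impI)
  have c: "comb (g ` A) (\<lambda>w. w) m = g (comb A (\<lambda>w. w) (\<lambda>v. m (g v)))" for m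
  proof -
    have "comb (g ` A) (\<lambda>w. w) m = (\<Sum>v\<in>A. m (g v) *\<^sub>R g v)"
      unfolding comb_def using inj by (subst sum.reindex) (auto intro: inj_on_subset)
    then show ?thesis using lin by (simp add: comb_def linear_sum linear_cmul)
  qed
  have g0: "g x = 0 \<longleftrightarrow> x = 0" for x using linear_0[OF lin] inj by (metis injD)
  fix m assume "comb (g ` A) (\<lambda>w. w) m = 0"
  then have "comb A (\<lambda>w. w) (\<lambda>v. m (g v)) = 0" by (simp add: c g0)
  then show "comb (g ` A) (\<lambda>w. w) (\<lambda>i. max 0 (m i)) = 0"
    unfolding c g0 by (rule kernel_sublatticeD[OF L])
qed

lemma kernel_sublattice_GL_image_obtuse:
  fixes \<Lambda> :: "(real ^ 'n) set"
  assumes fin: "finite \<Lambda>" and A: "obtuse A" "is_GL_image \<Lambda> A"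
  shows "kernel_sublattice \<Lambda> (\<lambda>w. w)"
proof -
  obtain M :: "real ^ 'n ^ 'n" where M: "invertible M" "\<Lambda> = (\<lambda>w. M *v w) ` A"
    using A(2) by (auto simp: is_GL_image_def)
  have inj: "inj (\<lambda>w. M *v w)"
    using M(1) unfolding invertible_left_inverse matrix_left_invertible_injective .
  have "finite A" using fin M(2) inj by (metis finite_imageD inj_on_subset subset_UNIV)
  then show ?thesis
    unfolding M(2) by (intro kernel_sublattice_injective_image kernel_sublattice_obtuse A inj) simp_all
qed

text \<open>In the coordinates given by \<open>g\<close>, the vectors of \<open>g ` Basis\<close> become the
standard basis. For any other vector \<open>g v\<close> of the set, the positive part of the dependency
between \<open>g v\<close> and this basis shows that the coordinates of \<open>v\<close> are at most zero. For
two such vectors, the positive part of the difference of their dependencies shows that no coordinate is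
nonzero in both, so they are orthogonal.\<close>
lemma obtuse_preimage_of_kernel_sublattice:
  fixes \<Lambda> :: "'a::euclidean_space set" and g :: "'a \<Rightarrow> 'a"
  assumes fin: "finite \<Lambda>" and L: "kernel_sublattice \<Lambda> (\<lambda>w. w)"
    and lin: "linear g" and inj: "inj g" and B: "g ` Basis \<subseteq> \<Lambda>"
    and x: "g x \<in> \<Lambda>" and y: "g y \<in> \<Lambda>" and xy: "x \<noteq> y"
  shows "x \<bullet> y \<le> 0"
proof -
  let ?B = "Basis :: 'a set"
  have inj': "inj_on g ?B" using inj by (rule inj_on_subset) simp
  \<comment> \<open>Coefficients on the standard basis, carried over to coefficients on \<open>\<Lambda>\<close>.\<close>
  define ext where "ext = (\<lambda>h w. if w \<in> g ` ?B then h (inv_into ?B g w) else 0 :: real)"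
  have ext: "comb \<Lambda> (\<lambda>w. w) (ext h) = g (\<Sum>b\<in>?B. h b *\<^sub>R b)" for h
  proof -
    have "comb \<Lambda> (\<lambda>w. w) (ext h) = (\<Sum>b\<in>?B. ext h (g b) *\<^sub>R g b)"
      unfolding comb_def by (rule sum_over_injection[OF fin inj' B]) (simp add: ext_def)
    also have "\<dots> = (\<Sum>b\<in>?B. h b *\<^sub>R g b)" using inj' by (intro sum.cong) (simp_all add: ext_def)
    finally show ?thesis using lin by (simp add: linear_sum linear_cmul)
  qed
  have single: "comb \<Lambda> (\<lambda>w. w) (\<lambda>w. if w = u then 1 else 0) = u" if "u \<in> \<Lambda>" for u
    using fin that by (simp add: comb_def if_distrib[of "\<lambda>c. c *\<^sub>R _"] cong: if_cong)
  have rep: "(\<Sum>b\<in>?B. (v \<bullet> b) *\<^sub>R b) = v" for v :: 'a by (rule euclidean_representation)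
  have coord: "v \<bullet> b = - h b" if "g v + g (\<Sum>b\<in>?B. h b *\<^sub>R b) = 0" "b \<in> ?B" for v b h
  proof -
    have "g (v + (\<Sum>b\<in>?B. h b *\<^sub>R b)) = g 0" using that lin by (simp add: linear_add linear_0)
    then have "v + (\<Sum>b\<in>?B. h b *\<^sub>R b) = 0" using inj by (simp add: inj_eq)
    then have "(v + (\<Sum>b\<in>?B. h b *\<^sub>R b)) \<bullet> b = 0" by simp
    then show ?thesis using that(2) by (simp add: inner_add_left)
  qed
  have neg: "v \<bullet> b = - max 0 (- (v \<bullet> b))" if v: "g v \<in> \<Lambda>" "g v \<notin> g ` ?B" and b: "b \<in> ?B" for v b
  proof -
    define m where "m = (\<lambda>w. 1 * (if w = g v then 1 else 0) + 1 * ext (\<lambda>b. - (v \<bullet> b)) w)"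
    have "comb \<Lambda> (\<lambda>w. w) m = 0"
      unfolding m_def comb_mix ext single[OF v(1)] using lin rep[of v] by (simp add: sum_negf linear_neg)
    then have "comb \<Lambda> (\<lambda>w. w) (\<lambda>w. max 0 (m w)) = 0" by (rule kernel_sublatticeD[OF L])
    moreover have "(\<lambda>w. max 0 (m w)) = (\<lambda>w. 1 * (if w = g v then 1 else 0) + 1 * ext (\<lambda>b. max 0 (- (v \<bullet> b))) w)"
      using v by (auto simp: m_def ext_def fun_eq_iff)
    ultimately have "g v + g (\<Sum>b\<in>?B. max 0 (- (v \<bullet> b)) *\<^sub>R b) = 0"
      by (simp only: comb_mix ext single[OF v(1)] scaleR_one)
    from coord[OF this b] show ?thesis .
  qed
  have gB: "v \<in> ?B" if "g v \<in> g ` ?B" for v using that inj by (auto simp: inj_eq)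
  consider "x \<in> ?B" "y \<in> ?B" | "x \<in> ?B" "g y \<notin> g ` ?B" | "g x \<notin> g ` ?B" "y \<in> ?B" | "g x \<notin> g ` ?B" "g y \<notin> g ` ?B"
    using gB by blast
  then show ?thesis
  proof cases
    case 1
    then show ?thesis using xy by (simp add: inner_not_same_Basis)
  next
    case 2
    then show ?thesis using neg[OF y _ 2(1)] by (simp add: inner_commute)
  next
    case 3
    then show ?thesis using neg[OF x _ 3(2)] by simp
  next
    case 4
    have "x \<bullet> b = - max 0 (y \<bullet> b - x \<bullet> b)" if b: "b \<in> ?B" for b
    proof -
      define m where "m = (\<lambda>w. 1 * (1 * (if w = g x then 1 else 0) + (- 1) * (if w = g y then 1 else 0)) + 1 * ext (\<lambda>b. y \<bullet> b - x \<bullet> b) w)"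
      have "comb \<Lambda> (\<lambda>w. w) m = 0"
        unfolding m_def comb_mix ext single[OF x] single[OF y] scaleR_left_diff_distrib sum_subtractf rep
        using lin by (simp add: linear_diff)
      then have "comb \<Lambda> (\<lambda>w. w) (\<lambda>w. max 0 (m w)) = 0" by (rule kernel_sublatticeD[OF L])
      moreover have "(\<lambda>w. max 0 (m w)) = (\<lambda>w. 1 * (if w = g x then 1 else 0) + 1 * ext (\<lambda>b. max 0 (y \<bullet> b - x \<bullet> b)) w)"
        using 4 xy inj by (auto simp: m_def ext_def fun_eq_iff inj_eq)
      ultimately have "g x + g (\<Sum>b\<in>?B. max 0 (y \<bullet> b - x \<bullet> b) *\<^sub>R b) = 0"
        by (simp only: comb_mix ext single[OF x] scaleR_one)
      from coord[OF this b] show ?thesis .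
    qed
    then have "(x \<bullet> b) * (y \<bullet> b) = 0" if "b \<in> ?B" for b
      using neg[OF x 4(1) that] neg[OF y 4(2) that] that by (fastforce simp: max_def split: if_splits)
    then have "(\<Sum>b\<in>?B. (x \<bullet> b) * (y \<bullet> b)) = 0" by (intro sum.neutral) blast
    then show ?thesis by (simp add: euclidean_inner[of x y])
  qed
qed

lemma GL_image_obtuse_of_kernel_sublattice:
  fixes \<Lambda> :: "(real ^ 'n) set"
  assumes fin: "finite \<Lambda>" and span: "span \<Lambda> = UNIV" and L: "kernel_sublattice \<Lambda> (\<lambda>w. w)"
  shows "\<exists>A. obtuse A \<and> is_GL_image \<Lambda> A"
proof -
  let ?B = "Basis :: (real ^ 'n) set"
  obtain S where S: "S \<subseteq> \<Lambda>" "independent S" "\<Lambda> \<subseteq> span S"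
    using maximal_independent_subset[of \<Lambda>] by blast
  have "span S = UNIV" using S span by (metis span_minimal subspace_span top.extremum_uniqueI)
  then have "card S = DIM(real ^ 'n)" using dim_eq_card[of S "UNIV :: (real ^ 'n) set"] S(2) by simp
  then obtain \<sigma> where \<sigma>: "bij_betw \<sigma> ?B S"
    using finite_same_card_bij[of ?B S] finite_subset[OF S(1) fin] by auto
  obtain g where g: "linear g" "\<And>b. b \<in> ?B \<Longrightarrow> g b = \<sigma> b"
    using linear_independent_extend[OF independent_Basis, of \<sigma>] by blast
  have gB: "g ` ?B = S" using \<sigma> g(2) by (auto simp: bij_betw_def)
  have "range g = UNIV"
  proof -
    have "span S \<subseteq> range g"
      using gB by (intro span_minimal linear_subspace_image g subspace_UNIV) auto
    then show ?thesis using \<open>span S = UNIV\<close> by auto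
  qed
  then have surj: "surj g" .
  then have inj: "inj g" using linear_surjective_imp_injective[OF g(1)] by blast
  have mat: "(\<lambda>w. matrix g *v w) = g" using matrix_works[OF g(1)[unfolded linear_matrix_vector_mul_eq[symmetric]]] by auto
  have "invertible (matrix g)"
    unfolding invertible_right_inverse matrix_right_invertible_surjective mat by (rule surj)
  moreover have "\<Lambda> = (\<lambda>w. matrix g *v w) ` (g -` \<Lambda>)" unfolding mat using surj by (simp add: surj_image_vimage_eq)
  ultimately have "is_GL_image \<Lambda> (g -` \<Lambda>)" unfolding is_GL_image_def by blast
  moreover have "obtuse (g -` \<Lambda>)"
    unfolding obtuse_def inner_pos_def
  proof (intro ballI impI)
    fix u v assume "u \<in> g -` \<Lambda>" "v \<in> g -` \<Lambda>" "u \<noteq> v"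
    then have "u \<bullet> v \<le> 0"
      using obtuse_preimage_of_kernel_sublattice[OF fin L g(1) inj] gB S(1) by auto
    then show "max 0 (u \<bullet> v) = 0" by simp
  qed
  ultimately show ?thesis by blast
qed

section \<open>The volume ratio\<close>

text \<open>By convexity the graph of \<open>\<phi>\<close> lies strictly below the diagonal on all of
\<open>(0,1)\<close> as soon as it does so at one point; the midpoint is what the strictness argument
uses.\<close>
lemma phi_half:
  assumes orl: "\<phi> \<in> orlicz_class" and t: "t \<in> {0..1}" "\<phi> t \<noteq> t"
  shows "\<phi> (1 / 2) < 1 / 2"
proof -
  have t': "0 < t" "t < 1" "\<phi> t < t"
    using t phi_zero[OF orl] phi_one[OF orl] phi_le_self[OF orl, of t] by (auto simp: less_le)
  show ?thesis
  proof (cases "1 / 2 \<le> t")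
    case True
    have "\<phi> (1 / (2 * t) * t) \<le> 1 / (2 * t) * \<phi> t"
      using t' True by (intro phi_scale[OF orl]) (auto simp: field_simps)
    also have "\<dots> < 1 / (2 * t) * t" using t' by (intro mult_strict_left_mono) auto
    finally show ?thesis using t' by simp
  next
    case False
    define s where "s = (1 / 2 - t) / (1 - t)"
    have s: "0 < s" "s < 1" using t' False by (auto simp: s_def field_simps)
    have "s * (1 - t) = 1 / 2 - t" using t' by (simp add: s_def)
    then have e: "(1 - s) * t + s * 1 = 1 / 2" by (simp add: algebra_simps)
    have "\<phi> ((1 - s) * t + s * 1) \<le> (1 - s) * \<phi> t + s * \<phi> 1"
      using s t' by (intro phi_mix[OF orl]) auto
    also have "\<dots> < (1 - s) * t + s * 1" using s t' by (simp add: phi_one[OF orl])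
    finally show ?thesis unfolding e .
  qed
qed

text \<open>Every entry of a feasible vector is at most one, so only the restriction of \<open>\<phi>\<close>
to \<open>[0,1]\<close> matters.\<close>
lemma orlicz_corner_identity:
  assumes orl: "\<phi> \<in> orlicz_class" and id: "\<forall>t\<in>{0..1}. \<phi> t = t" and I: "finite I"
  shows "orlicz_corner \<phi> I = orlicz_corner (\<lambda>t. t) I"
proof -
  have "(\<Sum>i\<in>I. \<phi> (x i)) \<le> 1 \<longleftrightarrow> (\<Sum>i\<in>I. x i) \<le> 1" if x: "\<forall>i\<in>I. 0 \<le> x i" for x :: "'a \<Rightarrow> real"
  proof
    assume *: "(\<Sum>i\<in>I. \<phi> (x i)) \<le> 1"
    have "\<phi> (x i) = x i" if "i \<in> I" for i
      using feasible_le_one[OF orl I _ * that] x id that by auto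
    then show "(\<Sum>i\<in>I. x i) \<le> 1" using * by simp
  next
    assume *: "(\<Sum>i\<in>I. x i) \<le> 1"
    have "\<phi> (x i) = x i" if "i \<in> I" for i
      using feasible_le_one[OF identity_orlicz I _ * that] x id that by auto
    then show "(\<Sum>i\<in>I. \<phi> (x i)) \<le> 1" using * by simp
  qed
  then show ?thesis unfolding orlicz_corner_def by (intro Collect_cong conj_cong refl all_cong1 imp_cong) blast
qed

theorem theorem1p2:
  fixes \<phi> :: "real \<Rightarrow> real" and \<Lambda> :: "(real ^ 'n) set"
  assumes "\<phi> \<in> orlicz_class"
    and "finite \<Lambda>" and "0 \<notin> \<Lambda>" and "span \<Lambda> = UNIV"
  shows "volume_ratio \<phi> \<Lambda> \<le> volume_ratio \<phi> (Basis :: (real ^ 'n) set) \<and>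
         (volume_ratio \<phi> \<Lambda> = volume_ratio \<phi> (Basis :: (real ^ 'n) set) \<longleftrightarrow>
            (\<exists>A. obtuse A \<and> is_GL_image \<Lambda> A) \<or> (\<forall>t\<in>{0..1}. \<phi> t = t))"
proof -
  let ?B = "Basis :: (real ^ 'n) set"
  define c where "c = volume_ratio \<phi> ?B"
  define V where "V = volume (orlicz_zonotope \<phi> \<Lambda>)"
  define U where "U = volume (orlicz_zonotope (\<lambda>t. t) \<Lambda>)"
  have pos: "0 < volume (orlicz_zonotope (\<lambda>t. t) S)" if "finite S" "span S = UNIV" for S :: "(real ^ 'n) set"
  proof -
    interpret convex_corner S "orlicz_corner (\<lambda>t. t) S" by (rule convex_corner_orlicz[OF identity_orlicz that(1)])
    show ?thesis
      unfolding orlicz_zonotope_eq_comb[OF identity_orlicz that(1)] using that by (intro comb_positive_volume) simp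
  qed
  have U: "U > 0" unfolding U_def using assms by (intro pos)
  have VU: "volume_ratio \<phi> \<Lambda> = V / U" by (simp add: volume_ratio_def V_def U_def)
  note cmp = comb_volume_comparison[OF assms(1,2), of "\<lambda>w. w", folded orlicz_zonotope_eq_comb[OF assms(1,2)]
      orlicz_zonotope_eq_comb[OF identity_orlicz assms(2)], folded V_def U_def c_def]
  have sub: "kernel_sublattice \<Lambda> (\<lambda>w. w) \<longleftrightarrow> (\<exists>A. obtuse A \<and> is_GL_image \<Lambda> A)"
    using kernel_sublattice_GL_image_obtuse[OF assms(2)] GL_image_obtuse_of_kernel_sublattice[OF assms(2,4)] by blast
  have le: "V / U \<le> c" using cmp U by (simp add: field_simps)
  have eq_sub: "V / U = c" if "\<exists>A. obtuse A \<and> is_GL_image \<Lambda> A"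
    using cmp that U unfolding sub by (simp add: field_simps)
  have eq_id: "V / U = c" if id: "\<forall>t\<in>{0..1}. \<phi> t = t"
  proof -
    have "volume_ratio \<phi> S = 1" if S: "finite S" "span S = UNIV" for S :: "(real ^ 'n) set"
      using pos[OF S] unfolding volume_ratio_def orlicz_zonotope_eq_comb[OF assms(1) S(1)]
        orlicz_zonotope_eq_comb[OF identity_orlicz S(1)] orlicz_corner_identity[OF assms(1) id S(1)] by simp
    then show ?thesis using assms VU[symmetric] by (simp add: c_def)
  qed
  have less: "V / U < c" if "\<not> (\<exists>A. obtuse A \<and> is_GL_image \<Lambda> A)" "\<not> (\<forall>t\<in>{0..1}. \<phi> t = t)"
  proof -
    have "\<phi> (1 / 2) < 1 / 2" using that(2) phi_half[OF assms(1)] by blast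
    then have "V < c * U" using cmp that(1) assms(4) unfolding sub by simp
    then show ?thesis using U by (simp add: field_simps)
  qed
  show ?thesis unfolding VU c_def[symmetric] using le eq_sub eq_id less by (metis less_irrefl)
qed

end
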